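(* Let $0<r_1<r_2$ and let the flow at the inlet $y_1=r_1$ be prescribed by $$\bar{\mathbf u}(r_1)=(\bar u_0^-,0,0)^{\top},\qquad \bar n(r_1)=\bar n_0^->0,\qquad \bar S(r_1)=\bar S_0^->0,$$ where $\bar u_0^-,\bar n_0^-,\bar S_0^-$ are constants with $0<\bar u_0^-<c$ and the inlet flow is supersonic, i.e. $(\bar u_0^-)^2>c_s^2(\bar n_0^-,\bar S_0^-)>0$. Then there exist two positive constants $P_1<P_2$, depending only on the incoming supersonic flow and on $r_1,r_2$, such that for any given exit pressure $p_e\in(P_1,P_2)$ the one-dimensional system $$\Big(y_1^2\frac{\bar n\bar u}{\sqrt{c^2-\bar u^2}}\Big)'=0,\qquad \bar u\bar u'+\frac{c^2-\bar u^2}{\bar p+\bar\rho c^2}\,\bar p'=0,\qquad \bar{\mathcal B}'=0$$ admits a unique piecewise smooth shock solution $$\bar{\mathbf\Psi}(y_1)=\begin{cases}\bar{\mathbf\Psi}^-(y_1)=(\bar u^-,0,0,\bar n^-,\bar S^-)(y_1),& y_1\in[r_1,r_s),\\ \bar{\mathbf\Psi}^+(y_1)=(\bar u^+,0,0,\bar n^+,\bar S^+)(y_1),& y_1\in(r_s,r_2],\end{cases}$$ which satisfies the prescribed incoming supersonic state at $y_1=r_1$ and the exit boundary condition $\bar p^+(r_2)=p_e$, with a shock front at $y_1=r_s\in(r_1,r_2)$ at which the Rankine–Hugoniot conditions and the physical entropy condition $$\Big[\frac{\bar n\bar u}{\sqrt{c^2-\bar u^2}}\Big](r_s)=\Big[\frac{\bar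 p+\bar\rho c^2}{c^2-\bar u^2}\bar u^2+\bar p\Big](r_s)=[\bar{\mathcal B}](r_s)=0,\qquad \bar S^+>\bar S^-$$ hold. Moreover, the shock position $r_s$ increases as the exit pressure $p_e$ decreases.
   Context: The system is the spherically symmetric reduction (purely radial velocity $\bar u(y_1)$, $y_1$ = radius, $'=d/dy_1$) of the steady relativistic Euler equations. The constant $c>0$ is the speed of light, $\bar n$ the rest mass density, $\bar S$ the entropy, $\bar p$ the pressure, $\bar\rho$ the mass-energy density. Thermodynamics (ideal polytropic gas), with constants $\gamma>1$ (adiabatic exponent), $R>0$ (gas constant), $C_v=R/(\gamma-1)$: $p=K(S)n^\gamma$; specific internal energy $e=C_vT=\frac{p}{(\gamma-1)n}$, $T$ the temperature; $\rho=n(1+e/c^2)$; the first law $T\,dS=de+p\,d(1/n)$ holds (so $K(S)=A\,e^{S/C_v}$ for a constant $A>0$). The local sound speed is $c_s=\sqrt{\partial_\rho p}$ (derivative at fixed $S$), viewed as a function $c_s(n,S)$. The relativistic Bernoulli quantity of the one-dimensional flow is $\bar{\mathcal B}=\dfrac{\bar p+\bar\rho c^2}{\bar n\sqrt{c^2-\bar u^2}}$. $[f](r_s)=f(r_s+)-f(r_s-)$ denotes the jump across $y_1=r_s$. Superscripts $-$ and $+$ denote the states upstream ($y_1<r_s$) and downstream ($y_1>r_s$) of the shock. *)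

theory Defs
  imports "HOL-Analysis.Analysis"
begin

text \<open>
  Ideal polytropic gas.  Parameters throughout: speed of light \<open>c\<close>, adiabatic exponent \<open>\<gamma>\<close>,
  gas constant \<open>R\<close> and the constant \<open>A\<close> in \<open>K(S) = A exp (S / C\<^sub>v)\<close>, \<open>C\<^sub>v = R / (\<gamma> - 1)\<close>,
  the form of \<open>K\<close> forced by the first law (see \<open>first_law\<close> below).
\<close>

definition heat_capacity :: "real \<Rightarrow> real \<Rightarrow> real" where
  "heat_capacity \<gamma> R = R / (\<gamma> - 1)"

definition pressure :: "real \<Rightarrow> real \<Rightarrow> real \<Rightarrow> real \<Rightarrow> real \<Rightarrow> real" where
  "pressure \<gamma> R A n S = A * exp (S / heat_capacity \<gamma> R) * n powr \<gamma>"

definition internal_energy :: "real \<Rightarrow> real \<Rightarrow> real \<Rightarrow> real \<Rightarrow> real \<Rightarrow> real" where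
  "internal_energy \<gamma> R A n S = pressure \<gamma> R A n S / ((\<gamma> - 1) * n)"

definition temperature :: "real \<Rightarrow> real \<Rightarrow> real \<Rightarrow> real \<Rightarrow> real \<Rightarrow> real" where
  "temperature \<gamma> R A n S = internal_energy \<gamma> R A n S / heat_capacity \<gamma> R"

definition energy_density :: "real \<Rightarrow> real \<Rightarrow> real \<Rightarrow> real \<Rightarrow> real \<Rightarrow> real \<Rightarrow> real" where
  "energy_density c \<gamma> R A n S = n * (1 + internal_energy \<gamma> R A n S / c\<^sup>2)"

text \<open>\<open>T dS = de + p d(1/n)\<close>, i.e. \<open>\<partial>e/\<partial>S = T\<close> and \<open>\<partial>e/\<partial>n = p / n\<^sup>2\<close>.\<close>

lemma first_law:
  fixes \<gamma> R A n S :: real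
  assumes "\<gamma> > 1" "R > 0" "n > 0"
  shows "((\<lambda>s. internal_energy \<gamma> R A n s) has_real_derivative temperature \<gamma> R A n S) (at S)"
    and "((\<lambda>m. internal_energy \<gamma> R A m S) has_real_derivative pressure \<gamma> R A n S / n\<^sup>2) (at n)"
proof -
  have "heat_capacity \<gamma> R > 0"
    using assms by (simp add: heat_capacity_def)
  then have "((\<lambda>s. exp (s / heat_capacity \<gamma> R)) has_real_derivative
      exp (S / heat_capacity \<gamma> R) / heat_capacity \<gamma> R) (at S)"
    by (auto intro!: derivative_eq_intros)
  from DERIV_cdivide[OF DERIV_cmult_right[OF DERIV_cmult[OF this]],
      where c = "(\<gamma> - 1) * n"]
  show "((\<lambda>s. internal_energy \<gamma> R A n s) has_real_derivative temperature \<gamma> R A n S) (at S)"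
    unfolding internal_energy_def temperature_def pressure_def
    by (simp add: ac_simps)
  have p: "n powr (\<gamma> - 1) = n powr \<gamma> / n"
    using assms by (simp add: powr_diff)
  have "((\<lambda>m. A * exp (S / heat_capacity \<gamma> R) * m powr \<gamma> / ((\<gamma> - 1) * m)) has_real_derivative
      ((A * exp (S / heat_capacity \<gamma> R) * (\<gamma> * n powr (\<gamma> - 1))) * ((\<gamma> - 1) * n) -
        A * exp (S / heat_capacity \<gamma> R) * n powr \<gamma> * (\<gamma> - 1)) / (((\<gamma> - 1) * n) * ((\<gamma> - 1) * n))) (at n)"
    using assms by (intro DERIV_divide DERIV_cmult DERIV_cmult_Id has_real_derivative_powr) auto
  moreover have "((K * (\<gamma> * n powr (\<gamma> - 1))) * ((\<gamma> - 1) * n) - K * n powr \<gamma> * (\<gamma> - 1)) /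
      (((\<gamma> - 1) * n) * ((\<gamma> - 1) * n)) = K * n powr \<gamma> / n\<^sup>2" for K :: real
  proof -
    have "(K * (\<gamma> * n powr (\<gamma> - 1))) * ((\<gamma> - 1) * n) - K * n powr \<gamma> * (\<gamma> - 1) =
        (\<gamma> - 1) * (\<gamma> - 1) * (K * n powr \<gamma>)"
      unfolding p using assms by (simp add: field_simps)
    then show ?thesis
      using assms by (simp add: power2_eq_square)
  qed
  ultimately show "((\<lambda>m. internal_energy \<gamma> R A m S) has_real_derivative pressure \<gamma> R A n S / n\<^sup>2) (at n)"
    unfolding internal_energy_def pressure_def by simp
qed

text \<open>
  The sound speed \<open>\<surd>(\<partial>p/\<partial>\<rho>)\<close> at fixed \<open>S\<close>: here \<open>p\<close> is regarded as a function of \<open>\<rho>\<close> by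
  inverting the (strictly increasing) map \<open>n \<mapsto> \<rho>(n, S)\<close> on \<open>n > 0\<close>.
\<close>

definition pressure_of_energy_density ::
    "real \<Rightarrow> real \<Rightarrow> real \<Rightarrow> real \<Rightarrow> real \<Rightarrow> real \<Rightarrow> real" where
  "pressure_of_energy_density c \<gamma> R A \<rho> S =
     pressure \<gamma> R A (inv_into {0<..} (\<lambda>n. energy_density c \<gamma> R A n S) \<rho>) S"

definition sound_speed :: "real \<Rightarrow> real \<Rightarrow> real \<Rightarrow> real \<Rightarrow> real \<Rightarrow> real \<Rightarrow> real" where
  "sound_speed c \<gamma> R A n S =
     sqrt (deriv (\<lambda>\<rho>. pressure_of_energy_density c \<gamma> R A \<rho> S) (energy_density c \<gamma> R A n S))"

definition mass_flux :: "real \<Rightarrow> real \<Rightarrow> real \<Rightarrow> real" where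
  "mass_flux c u n = n * u / sqrt (c\<^sup>2 - u\<^sup>2)"

definition momentum_flux :: "real \<Rightarrow> real \<Rightarrow> real \<Rightarrow> real \<Rightarrow> real \<Rightarrow> real \<Rightarrow> real \<Rightarrow> real" where
  "momentum_flux c \<gamma> R A u n S =
     (pressure \<gamma> R A n S + energy_density c \<gamma> R A n S * c\<^sup>2) / (c\<^sup>2 - u\<^sup>2) * u\<^sup>2 + pressure \<gamma> R A n S"

definition bernoulli :: "real \<Rightarrow> real \<Rightarrow> real \<Rightarrow> real \<Rightarrow> real \<Rightarrow> real \<Rightarrow> real \<Rightarrow> real" where
  "bernoulli c \<gamma> R A u n S =
     (pressure \<gamma> R A n S + energy_density c \<gamma> R A n S * c\<^sup>2) / (n * sqrt (c\<^sup>2 - u\<^sup>2))"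

text \<open>
  The steady spherically symmetric system at radius \<open>y\<close>.  Derivatives are taken within \<open>D\<close>,
  hence one-sided at end points of the flow region.
\<close>

definition euler_at ::
    "real \<Rightarrow> real \<Rightarrow> real \<Rightarrow> real \<Rightarrow> (real \<Rightarrow> real) \<Rightarrow> (real \<Rightarrow> real) \<Rightarrow> (real \<Rightarrow> real) \<Rightarrow> real set \<Rightarrow> real \<Rightarrow> bool"
where
  "euler_at c \<gamma> R A u n S D y \<longleftrightarrow>
     ((\<lambda>x. x\<^sup>2 * mass_flux c (u x) (n x)) has_real_derivative 0) (at y within D) \<and>
     (\<exists>u' p'.
        (u has_real_derivative u') (at y within D) \<and>
        ((\<lambda>x. pressure \<gamma> R A (n x) (S x)) has_real_derivative p') (at y within D) \<and>
        u y * u' + (c\<^sup>2 - (u y)\<^sup>2) /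
          (pressure \<gamma> R A (n y) (S y) + energy_density c \<gamma> R A (n y) (S y) * c\<^sup>2) * p' = 0) \<and>
     ((\<lambda>x. bernoulli c \<gamma> R A (u x) (n x) (S x)) has_real_derivative 0) (at y within D)"

definition has_jump :: "(real \<Rightarrow> real) \<Rightarrow> real \<Rightarrow> real \<Rightarrow> bool" where
  "has_jump f j r \<longleftrightarrow>
     (\<exists>a b. (f \<longlongrightarrow> a) (at_left r) \<and> (f \<longlongrightarrow> b) (at_right r) \<and> j = b - a)"

text \<open>
  \<open>f\<close> is infinitely differentiable on \<open>[r\<^sub>1, r\<^sub>2] - {r\<^sub>s}\<close> (one-sidedly at \<open>r\<^sub>1\<close>, \<open>r\<^sub>2\<close>), and
  \<open>f\<close> and all its derivatives \<open>g k\<close> have finite one-sided limits at \<open>r\<^sub>s\<close>.  The value \<open>f r\<^sub>s\<close> is irrelevant.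
\<close>

definition piecewise_smooth :: "real \<Rightarrow> real \<Rightarrow> real \<Rightarrow> (real \<Rightarrow> real) \<Rightarrow> bool" where
  "piecewise_smooth r1 r2 rs f \<longleftrightarrow>
     (\<exists>g :: nat \<Rightarrow> real \<Rightarrow> real. g 0 = f \<and>
        (\<forall>k. (\<forall>y\<in>{r1..r2} - {rs}.
                (g k has_real_derivative g (Suc k) y) (at y within {r1..r2} - {rs})) \<and>
             (\<exists>a. (g k \<longlongrightarrow> a) (at_left rs)) \<and>
             (\<exists>b. (g k \<longlongrightarrow> b) (at_right rs))))"

text \<open>
  A shock solution with front at \<open>r\<^sub>s\<close>: the restrictions of \<open>(u, n, S)\<close> to \<open>[r\<^sub>1, r\<^sub>s)\<close> and
  \<open>(r\<^sub>s, r\<^sub>2]\<close> are the upstream and downstream states; the angular velocity components vanish.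
\<close>

definition shock_solution ::
    "real \<Rightarrow> real \<Rightarrow> real \<Rightarrow> real \<Rightarrow> real \<Rightarrow> real \<Rightarrow> real \<Rightarrow> real \<Rightarrow> real \<Rightarrow> real \<Rightarrow>
     real \<Rightarrow> (real \<Rightarrow> real) \<Rightarrow> (real \<Rightarrow> real) \<Rightarrow> (real \<Rightarrow> real) \<Rightarrow> bool"
where
  "shock_solution c \<gamma> R A r1 r2 u0 n0 S0 pe rs u n S \<longleftrightarrow>
     r1 < rs \<and> rs < r2 \<and>
     piecewise_smooth r1 r2 rs u \<and> piecewise_smooth r1 r2 rs n \<and> piecewise_smooth r1 r2 rs S \<and>
     (\<forall>y\<in>{r1..r2} - {rs}. \<bar>u y\<bar> < c \<and> n y > 0 \<and> euler_at c \<gamma> R A u n S ({r1..r2} - {rs}) y) \<and>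
     u r1 = u0 \<and> n r1 = n0 \<and> S r1 = S0 \<and>
     pressure \<gamma> R A (n r2) (S r2) = pe \<and>
     has_jump (\<lambda>y. mass_flux c (u y) (n y)) 0 rs \<and>
     has_jump (\<lambda>y. momentum_flux c \<gamma> R A (u y) (n y) (S y)) 0 rs \<and>
     has_jump (\<lambda>y. bernoulli c \<gamma> R A (u y) (n y) (S y)) 0 rs \<and>
     (\<exists>j>0. has_jump S j rs)"

end

theory Submission
  imports Defs "HOL-Complex_Analysis.Conformal_Mappings"
begin

text \<open>
  Write \<open>u = c v\<close>, let \<open>s = sqrt (1 - v\<^sup>2)\<close> be the inverse Lorentz factor and let \<open>w\<close> be the
  thermal part of the specific enthalpy in units of the rest energy, so that \<open>p + \<rho> c\<^sup>2 = n c\<^sup>2 (1 + w)\<close>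
  and the Bernoulli quantity is \<open>c (1 + w) / s\<close>.  The latter has the same value \<open>c H\<close> in the whole
  flow, on both sides of the shock.  Hence \<open>w = H s - 1\<close> is a function of \<open>v\<close>, and a state with mass
  flux \<open>j\<close> is determined by \<open>v\<close> alone: \<open>n = j s / v\<close>, the entropy is \<open>R (F v - ln j) + const\<close> and the
  momentum flux is \<open>c\<^sup>2 j M v\<close>, with two explicit functions \<open>F\<close> (below: \<open>log_flux\<close>) and \<open>M\<close> (\<open>impulse\<close>).
  With \<open>\<kappa> = (\<gamma> - 1) / \<gamma>\<close> their derivatives satisfy \<open>\<kappa> F' = - g M'\<close>, where \<open>g = v / (s w)\<close> is positive
  and increasing; both vanish at exactly one speed, the sonic one, where \<open>F\<close> is maximal and \<open>M\<close> minimal.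

  In a smooth region the momentum equation says that the entropy is constant.  As \<open>j = J / y\<^sup>2\<close>, this
  means that \<open>F (v y) + 2 ln y\<close> is constant, so \<open>F (v y)\<close> falls below its maximum as \<open>y\<close> grows: the
  flow never becomes sonic and stays on the supersonic or the subsonic branch of the inverse of \<open>F\<close>.  At
  the shock, mass flux and Bernoulli quantity being continuous, the momentum condition is
  \<open>M v\<^sub>+ = M v\<^sub>-\<close>.  Since \<open>M\<close> decreases up to the sonic speed and increases afterwards, \<open>v\<^sub>+\<close> is the
  subsonic preimage.

  Everything about the entropy follows from one remark (\<open>combined_less\<close>): with \<open>g\<^sub>*\<close> the value of \<open>g\<close> at
  the sonic speed, \<open>\<kappa> F + g\<^sub>* M\<close> is strictly decreasing, because its derivative is \<open>M' (g\<^sub>* - g)\<close> and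
  the two factors have opposite signs.  On a pair with \<open>M v\<^sub>+ = M v\<^sub>-\<close> and \<open>v\<^sub>+ < v\<^sub>-\<close> this gives
  \<open>E = F v\<^sub>+ - F v\<^sub>- > 0\<close>, so the entropy increases; and if \<open>v\<^sub>-\<close> grows, \<open>v\<^sub>+\<close> decreases and \<open>E\<close> grows.

  Finally the exit pressure is a constant multiple of \<open>s w / v\<close> at the exit speed, hence decreasing in that
  speed.  On the subsonic branch the speed increases with \<open>F\<close>, whose exit value is
  \<open>F v\<^sub>0 + 2 ln (r\<^sub>1 / r\<^sub>2) + E\<close>.  A shock further out meets a faster upstream flow and so has a larger \<open>E\<close>.
  Therefore the exit pressure is a continuous, strictly decreasing function of the shock position
  (\<open>exit_pressure_less\<close>, \<open>exit_pressure_cont\<close>), and \<open>P\<^sub>1\<close>, \<open>P\<^sub>2\<close> are its values at \<open>r\<^sub>2\<close> and \<open>r\<^sub>1\<close>.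
  This settles the claim once the formulas above are known to give a shock solution for every position
  (\<open>shock_solution_exists\<close>) and no others exist (\<open>shock_solution_eq\<close>).
\<close>

section \<open>Finitely often differentiable functions\<close>

text \<open>
  Smoothness of the flow is obtained by bootstrapping from the differential equation it solves, which
  needs a notion of finite order of differentiability that is closed under arithmetic.
\<close>

primrec times_differentiable :: "nat \<Rightarrow> real set \<Rightarrow> (real \<Rightarrow> real) \<Rightarrow> bool" where
  "times_differentiable 0 U f = True"
| "times_differentiable (Suc k) U f =
     ((\<forall>y\<in>U. f differentiable (at y)) \<and> times_differentiable k U (deriv f))"

lemma times_differentiable_DERIV:
  assumes "times_differentiable (Suc k) U f" "y \<in> U"
  shows "(f has_real_derivative deriv f y) (at y)"
  using assms by (simp add: DERIV_deriv_iff_real_differentiable)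

lemma times_differentiable_cong:
  assumes "open U" "\<And>y. y \<in> U \<Longrightarrow> f y = g y" "times_differentiable k U f"
  shows "times_differentiable k U g"
  using assms(2,3)
proof (induction k arbitrary: f g)
  case 0
  show ?case by simp
next
  case (Suc k)
  have g: "(g has_real_derivative deriv f y) (at y)" if "y \<in> U" for y
    using has_field_derivative_transform_within_open[OF times_differentiable_DERIV[OF Suc.prems(2) that]
        \<open>open U\<close> that] Suc.prems(1) by blast
  have "deriv f y = deriv g y" if "y \<in> U" for y
    using g[OF that] by (simp add: DERIV_imp_deriv)
  then have "times_differentiable k U (deriv g)"
    using Suc.IH[of "deriv f" "deriv g"] Suc.prems(2) by simp
  then show ?case
    using g by (auto simp: real_differentiable_def)
qed

lemma times_differentiable_SucI:
  assumes "open U" "\<And>y. y \<in> U \<Longrightarrow> (f has_real_derivative f' y) (at y)"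
    "times_differentiable k U f'"
  shows "times_differentiable (Suc k) U f"
proof -
  have "f' y = deriv f y" if "y \<in> U" for y
    using assms(2)[OF that] by (simp add: DERIV_imp_deriv)
  then have "times_differentiable k U (deriv f)"
    by (rule times_differentiable_cong[OF assms(1) _ assms(3)])
  then show ?thesis
    using assms(2) by (auto simp: real_differentiable_def)
qed

lemma times_differentiable_SucD:
  "times_differentiable (Suc k) U f \<Longrightarrow> times_differentiable k U f"
  by (induction k arbitrary: f) auto

lemma times_differentiable_const:
  assumes "open U"
  shows "times_differentiable k U (\<lambda>_. a)"
proof (induction k arbitrary: a)
  case (Suc k)
  show ?case
    by (rule times_differentiable_SucI[OF assms _ Suc[of 0]]) simp
qed simp

lemma times_differentiable_id:
  assumes "open U"
  shows "times_differentiable k U (\<lambda>y. y)"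
proof (cases k)
  case (Suc k)
  show ?thesis
    unfolding Suc
    by (rule times_differentiable_SucI[OF assms _ times_differentiable_const[OF assms, of _ 1]]) simp
qed simp

lemma times_differentiable_add:
  assumes "open U" "times_differentiable k U f" "times_differentiable k U g"
  shows "times_differentiable k U (\<lambda>y. f y + g y)"
  using assms(2,3)
proof (induction k arbitrary: f g)
  case (Suc k)
  show ?case
  proof (rule times_differentiable_SucI[OF assms(1)])
    show "((\<lambda>y. f y + g y) has_real_derivative deriv f y + deriv g y) (at y)" if "y \<in> U" for y
      by (intro DERIV_add times_differentiable_DERIV[OF Suc.prems(1) that]
          times_differentiable_DERIV[OF Suc.prems(2) that])
    show "times_differentiable k U (\<lambda>y. deriv f y + deriv g y)"
      using Suc.prems by (intro Suc.IH) auto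
  qed
qed simp

lemma times_differentiable_mult:
  assumes "open U" "times_differentiable k U f" "times_differentiable k U g"
  shows "times_differentiable k U (\<lambda>y. f y * g y)"
  using assms(2,3)
proof (induction k arbitrary: f g)
  case (Suc k)
  show ?case
  proof (rule times_differentiable_SucI[OF assms(1)])
    show "((\<lambda>y. f y * g y) has_real_derivative deriv f y * g y + deriv g y * f y) (at y)"
      if "y \<in> U" for y
      by (intro DERIV_mult times_differentiable_DERIV[OF Suc.prems(1) that]
          times_differentiable_DERIV[OF Suc.prems(2) that])
    show "times_differentiable k U (\<lambda>y. deriv f y * g y + deriv g y * f y)"
      using Suc.prems Suc.prems[THEN times_differentiable_SucD]
      by (intro times_differentiable_add[OF assms(1)] Suc.IH) auto
  qed
qed simp

lemma times_differentiable_inverse: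
  assumes "open U" "times_differentiable k U f" "\<And>y. y \<in> U \<Longrightarrow> f y \<noteq> 0"
  shows "times_differentiable k U (\<lambda>y. inverse (f y))"
  using assms(2)
proof (induction k)
  case (Suc k)
  note IH = Suc.IH[OF times_differentiable_SucD[OF Suc.prems]]
  show ?case
  proof (rule times_differentiable_SucI[OF assms(1)])
    show "((\<lambda>y. inverse (f y)) has_real_derivative
        (-1) * deriv f y * (inverse (f y) * inverse (f y))) (at y)"
      if "y \<in> U" for y
      using DERIV_inverse_fun[OF times_differentiable_DERIV[OF Suc.prems that] assms(3)[OF that]]
      by (simp add: field_simps)
    show "times_differentiable k U (\<lambda>y. (-1) * deriv f y * (inverse (f y) * inverse (f y)))"
      using Suc.prems IH
      by (intro times_differentiable_mult[OF assms(1)] times_differentiable_const[OF assms(1)]) auto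
  qed
qed simp

text \<open>
  The exponent has to be arbitrary in the induction, since differentiation lowers it by one.
\<close>

lemma times_differentiable_powr:
  assumes "open U" "times_differentiable k U f" "\<And>y. y \<in> U \<Longrightarrow> 0 < f y"
  shows "times_differentiable k U (\<lambda>y. f y powr a)"
  using assms(2)
proof (induction k arbitrary: a)
  case (Suc k)
  show ?case
  proof (rule times_differentiable_SucI[OF assms(1)])
    show "((\<lambda>y. f y powr a) has_real_derivative a * f y powr (a - 1) * deriv f y) (at y)"
      if "y \<in> U" for y
      using DERIV_fun_powr[OF times_differentiable_DERIV[OF Suc.prems that] assms(3)[OF that], of a]
      by simp
    show "times_differentiable k U (\<lambda>y. a * f y powr (a - 1) * deriv f y)"
      using Suc.prems Suc.IH[OF times_differentiable_SucD[OF Suc.prems]]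
      by (intro times_differentiable_mult[OF assms(1)] times_differentiable_const[OF assms(1)]) auto
  qed
qed simp

definition smooth_on :: "real set \<Rightarrow> (real \<Rightarrow> real) \<Rightarrow> bool" where
  "smooth_on U f \<longleftrightarrow> (\<forall>k. times_differentiable k U f)"

lemma smooth_on_deriv_funpow:
  assumes "smooth_on U f" "y \<in> U"
  shows "((deriv ^^ k) f has_real_derivative (deriv ^^ Suc k) f y) (at y)"
proof -
  have "times_differentiable j U ((deriv ^^ k) f)" for j
  proof (induction k arbitrary: j)
    case 0
    show ?case
      using assms(1) by (simp add: smooth_on_def)
  next
    case (Suc k)
    show ?case
      using Suc[of "Suc j"] by simp
  qed
  from times_differentiable_DERIV[OF this assms(2)] show ?thesis
    by simp
qed

text \<open>
  The two pieces are smooth across the shock, so the one-sided limits of all derivatives are simply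
  their values there.
\<close>

lemma piecewise_smooth_glue:
  assumes f: "smooth_on U f" and g: "smooth_on V g"
    and UV: "{r1..rs} \<subseteq> U" "{rs..r2} \<subseteq> V" and rs: "r1 < rs" "rs < r2"
  shows "piecewise_smooth r1 r2 rs (\<lambda>y. if y < rs then f y else g y)"
  unfolding piecewise_smooth_def
proof (intro exI[of _ "\<lambda>k y. if y < rs then (deriv ^^ k) f y else (deriv ^^ k) g y"] conjI allI ballI)
  let ?h = "\<lambda>k y. if y < rs then (deriv ^^ k) f y else (deriv ^^ k) g y"
  show "?h 0 = (\<lambda>y. if y < rs then f y else g y)"
    by (rule ext) simp
  fix k
  have df: "((deriv ^^ k) f has_real_derivative (deriv ^^ Suc k) f y) (at y)" if "y \<in> {r1..rs}" for y
    using smooth_on_deriv_funpow[OF f] that UV by blast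
  have dg: "((deriv ^^ k) g has_real_derivative (deriv ^^ Suc k) g y) (at y)" if "y \<in> {rs..r2}" for y
    using smooth_on_deriv_funpow[OF g] that UV by blast
  show "(?h k has_real_derivative ?h (Suc k) y) (at y within {r1..r2} - {rs})"
    if "y \<in> {r1..r2} - {rs}" for y
  proof (cases "y < rs")
    case True
    have "(?h k has_real_derivative (deriv ^^ Suc k) f y) (at y)"
      by (rule has_field_derivative_transform_within_open[OF df, of _ "{..<rs}"])
        (use that True in auto)
    then show ?thesis
      using True by (auto intro: has_field_derivative_at_within)
  next
    case False
    have "(?h k has_real_derivative (deriv ^^ Suc k) g y) (at y)"
      by (rule has_field_derivative_transform_within_open[OF dg, of _ "{rs<..}"])
        (use that False in auto)
    then show ?thesis
      using False by (auto intro: has_field_derivative_at_within)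
  qed
  have "((deriv ^^ k) f \<longlongrightarrow> (deriv ^^ k) f rs) (at_left rs)"
    using DERIV_isCont[OF df[of rs]] rs by (simp add: isCont_def filterlim_at_split)
  moreover have "\<forall>\<^sub>F y in at_left rs. (deriv ^^ k) f y = ?h k y"
    by (auto simp: eventually_at_filter)
  ultimately show "\<exists>a. (?h k \<longlongrightarrow> a) (at_left rs)"
    by (blast intro: Lim_transform_eventually)
  have "((deriv ^^ k) g \<longlongrightarrow> (deriv ^^ k) g rs) (at_right rs)"
    using DERIV_isCont[OF dg[of rs]] rs by (simp add: isCont_def filterlim_at_split)
  moreover have "\<forall>\<^sub>F y in at_right rs. (deriv ^^ k) g y = ?h k y"
    by (auto simp: eventually_at_filter)
  ultimately show "\<exists>b. (?h k \<longlongrightarrow> b) (at_right rs)"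
    by (blast intro: Lim_transform_eventually)
qed

section \<open>One-sided limits and jumps\<close>

lemma tendsto_at_left_eq:
  fixes f h :: "real \<Rightarrow> real"
  assumes "a < r" and eq: "\<And>y. a < y \<Longrightarrow> y < r \<Longrightarrow> h y = f y" and "isCont f r"
  shows "(h \<longlongrightarrow> f r) (at_left r)"
proof -
  have "\<forall>\<^sub>F y in at_left r. f y = h y"
    by (rule eventually_mono[OF eventually_at_left_real[OF assms(1)]]) (simp add: eq)
  moreover have "(f \<longlongrightarrow> f r) (at_left r)"
    using assms(3) unfolding isCont_def filterlim_at_split by blast
  ultimately show ?thesis
    by (blast intro: Lim_transform_eventually)
qed

lemma tendsto_at_right_eq:
  fixes g h :: "real \<Rightarrow> real"
  assumes "r < b" and eq: "\<And>y. r < y \<Longrightarrow> y < b \<Longrightarrow> h y = g y" and "isCont g r"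
  shows "(h \<longlongrightarrow> g r) (at_right r)"
proof -
  have "\<forall>\<^sub>F y in at_right r. g y = h y"
    by (rule eventually_mono[OF eventually_at_right_real[OF assms(1)]]) (simp add: eq)
  moreover have "(g \<longlongrightarrow> g r) (at_right r)"
    using assms(3) unfolding isCont_def filterlim_at_split by blast
  ultimately show ?thesis
    by (blast intro: Lim_transform_eventually)
qed

lemma has_jump_iff:
  assumes "(f \<longlongrightarrow> a) (at_left r)" "(f \<longlongrightarrow> b) (at_right r)"
  shows "has_jump f j r \<longleftrightarrow> j = b - a"
proof
  assume "has_jump f j r"
  then obtain a' b' where "(f \<longlongrightarrow> a') (at_left r)" "(f \<longlongrightarrow> b') (at_right r)" "j = b' - a'"
    unfolding has_jump_def by blast
  then show "j = b - a"
    using assms tendsto_unique[of "at_left r" f a' a] tendsto_unique[of "at_right r" f b' b]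
    by (simp add: trivial_limit_at_left_real)
qed (use assms in \<open>auto simp: has_jump_def\<close>)

lemma has_jump_pieces:
  fixes f g h :: "real \<Rightarrow> real"
  assumes r: "a < r" "r < b"
    and left: "\<And>y. a < y \<Longrightarrow> y < r \<Longrightarrow> h y = f y" and right: "\<And>y. r < y \<Longrightarrow> y < b \<Longrightarrow> h y = g y"
    and cont: "isCont f r" "isCont g r"
  shows "has_jump h j r \<longleftrightarrow> j = g r - f r"
  by (rule has_jump_iff[OF tendsto_at_left_eq[OF r(1) left cont(1)] tendsto_at_right_eq[OF r(2) right cont(2)]])

text \<open>
  For \<open>s\<close> the sonic speed, this keeps a flow that is never sonic on one branch.
\<close>

lemma continuous_avoids_value:
  fixes f :: "real \<Rightarrow> real"
  assumes "connected I" "continuous_on I f" "\<And>y. y \<in> I \<Longrightarrow> f y \<noteq> s" "a \<in> I" "b \<in> I"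
  shows "f a < s \<longleftrightarrow> f b < s"
proof -
  have *: "\<not> (f x < s \<and> s < f y)" if "x \<in> I" "y \<in> I" for x y
  proof
    assume "f x < s \<and> s < f y"
    moreover have "{f x..f y} \<subseteq> f ` I"
      using connected_contains_Icc[OF connected_continuous_image[OF assms(2,1)]] that by blast
    ultimately have "s \<in> f ` I"
      by (auto simp: subset_iff)
    then show False
      using assms(3) by blast
  qed
  show ?thesis
    using *[OF assms(4,5)] *[OF assms(5,4)] assms(3)[OF assms(4)] assms(3)[OF assms(5)] by linarith
qed

lemma piecewise_smooth_continuous_on:
  assumes "piecewise_smooth r1 r2 rs f"
  shows "continuous_on ({r1..r2} - {rs}) f" "\<exists>b. (f \<longlongrightarrow> b) (at_right rs)"
proof -
  obtain g where g: "g 0 = f"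
    "\<And>k y. y \<in> {r1..r2} - {rs} \<Longrightarrow>
       (g k has_real_derivative g (Suc k) y) (at y within {r1..r2} - {rs})"
    "\<And>k. \<exists>b. (g k \<longlongrightarrow> b) (at_right rs)"
    using assms unfolding piecewise_smooth_def by metis
  show "continuous_on ({r1..r2} - {rs}) f"
    using DERIV_continuous_on[OF g(2), of 0] g(1) by simp
  show "\<exists>b. (f \<longlongrightarrow> b) (at_right rs)"
    using g(3)[of 0] g(1) by simp
qed

section \<open>Inverse functions on an open set\<close>

lemma DERIV_inv_into:
  fixes f f' :: "real \<Rightarrow> real"
  assumes "inj_on f S" "open S"
    and der: "\<And>x. x \<in> S \<Longrightarrow> (f has_real_derivative f' x) (at x)"
    and "x \<in> S" "f' x \<noteq> 0"
  shows "(inv_into S f has_real_derivative inverse (f' x)) (at (f x))"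
proof (rule has_field_derivative_inverse_strong_x[where S = S and f = f])
  show "continuous_on S f"
    using der by (intro continuous_at_imp_continuous_on) (force intro: DERIV_isCont)
qed (use assms in \<open>auto simp: inv_into_f_f\<close>)

section \<open>Flow states on one Bernoulli level\<close>

text \<open>
  The inverse Lorentz factor, for a speed in units of the speed of light.
\<close>

definition lor :: "real \<Rightarrow> real" where
  "lor v = sqrt (1 - v\<^sup>2)"

lemma lor_pos: "\<bar>v\<bar> < 1 \<Longrightarrow> 0 < lor v"
  by (simp add: lor_def abs_square_less_1)

lemma lor_power2: "\<bar>v\<bar> < 1 \<Longrightarrow> (lor v)\<^sup>2 = 1 - v\<^sup>2"
  by (simp add: lor_def abs_square_le_1)

lemma lor_less: "0 \<le> x \<Longrightarrow> x < y \<Longrightarrow> lor y < lor x"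
  by (simp add: lor_def power_strict_mono)

lemma lor_deriv:
  assumes "\<bar>v\<bar> < 1"
  shows "(lor has_real_derivative - v / lor v) (at v)"
proof -
  have "0 < 1 - v\<^sup>2"
    using assms by (simp add: abs_square_less_1)
  then have "((\<lambda>v. sqrt (1 - v\<^sup>2)) has_real_derivative - v / sqrt (1 - v\<^sup>2)) (at v)"
    by (auto intro!: derivative_eq_intros simp: field_simps)
  then show ?thesis
    by (simp add: lor_def[abs_def])
qed

text \<open>
  The Bernoulli quantity is fixed to \<open>c H\<close>.  Since \<open>w > 0\<close> and \<open>s \<le> 1\<close>, every gas state
  has \<open>H = (1 + w) / s > 1\<close>.
\<close>

locale bernoulli_level =
  fixes \<gamma> H :: real
  assumes gamma: "1 < \<gamma>" and level: "1 < H"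
begin

definition \<kappa> :: real where
  "\<kappa> = (\<gamma> - 1) / \<gamma>"

text \<open>
  The value of the thermal enthalpy ratio \<open>w\<close> that the Bernoulli law \<open>(1 + w) / s = H\<close> leaves at speed \<open>v\<close>.
\<close>

definition thermal :: "real \<Rightarrow> real" where
  "thermal v = H * lor v - 1"

text \<open>
  The speed reached by expansion into vacuum, where \<open>thermal\<close> vanishes.
\<close>

definition vmax :: real where
  "vmax = sqrt (1 - 1 / H\<^sup>2)"

text \<open>
  The logarithm of the mass flux as a function of speed at fixed entropy, up to an additive constant
  that depends on the entropy.
\<close>

definition log_flux :: "real \<Rightarrow> real" where
  "log_flux v = ln (thermal v) / (\<gamma> - 1) + ln v - ln (lor v)"

text \<open>
  The momentum flux per unit of \<open>c\<^sup>2\<close> times the mass flux.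
\<close>

definition impulse :: "real \<Rightarrow> real" where
  "impulse v = H * v + \<kappa> * (lor v * thermal v) / v"

text \<open>
  The common factor of the derivatives of \<open>log_flux\<close> and \<open>impulse\<close>.  It is positive exactly for
  supersonic speeds (see \<open>supersonic_iff\<close>) and visibly increasing, which makes the sonic speed unique.
\<close>

definition mach_excess :: "real \<Rightarrow> real" where
  "mach_excess v = H * (1 - \<kappa>) * v\<^sup>2 - \<kappa> * H + \<kappa> / lor v"

lemma kappa: "0 < \<kappa>" "\<kappa> < 1" "1 / (\<gamma> - 1) = (1 - \<kappa>) / \<kappa>"
  using gamma by (auto simp: \<kappa>_def field_simps)

lemma vmax: "0 < vmax" "vmax < 1" "lor vmax = 1 / H"
proof -
  have H: "1 < H\<^sup>2"
    using level by (simp add: one_less_power)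
  then show "0 < vmax" "vmax < 1"
    using level by (simp_all add: vmax_def)
  have "1 / H\<^sup>2 \<le> 1"
    using H by (simp add: divide_le_eq)
  then have "vmax\<^sup>2 = 1 - 1 / H\<^sup>2"
    by (simp add: vmax_def)
  then show "lor vmax = 1 / H"
    using level by (simp add: lor_def real_sqrt_divide)
qed

lemma thermal_pos:
  assumes "0 \<le> v" "v < vmax"
  shows "0 < thermal v" "0 < lor v" "v < 1"
proof -
  show "v < 1" using assms vmax by simp
  then show "0 < lor v" using assms lor_pos by simp
  show "0 < thermal v"
    using lor_less[OF assms] vmax level by (simp add: thermal_def field_simps)
qed

lemma thermal_pos_imp_less_vmax:
  assumes "0 < thermal v"
  shows "v < vmax"
proof (rule ccontr)
  assume "\<not> v < vmax"
  then have "lor v \<le> lor vmax"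
    using lor_less[of vmax v] vmax by (cases "v = vmax") auto
  then show False
    using assms vmax level by (simp add: thermal_def field_simps)
qed

lemma thermal_deriv:
  assumes "0 \<le> v" "v < vmax"
  shows "(thermal has_real_derivative - H * v / lor v) (at v)"
  unfolding thermal_def[abs_def] using thermal_pos[OF assms] assms
  by (auto intro!: derivative_eq_intros lor_deriv)

lemma log_flux_deriv:
  assumes v: "0 < v" "v < vmax"
  shows "(log_flux has_real_derivative - mach_excess v / (\<kappa> * (v * thermal v * lor v))) (at v)"
proof -
  note pos = thermal_pos[OF less_imp_le[OF v(1)] v(2)]
  have s2: "(lor v)\<^sup>2 = 1 - v\<^sup>2"
    using pos v by (simp add: lor_power2)
  have H: "H = (1 + thermal v) / lor v"
    using pos by (simp add: thermal_def)
  have "(log_flux has_real_derivative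
      (- H * v / lor v) / thermal v / (\<gamma> - 1) + 1 / v - (- v / lor v) / lor v) (at v)"
    unfolding log_flux_def[abs_def] using pos v gamma
    by (auto intro!: derivative_eq_intros lor_deriv thermal_deriv)
  also have "(- H * v / lor v) / thermal v / (\<gamma> - 1) + 1 / v - (- v / lor v) / lor v
      = (- H * v / lor v) / thermal v * (1 / (\<gamma> - 1)) + (v\<^sup>2 + (lor v)\<^sup>2) / (v * (lor v)\<^sup>2)"
    using pos v by (simp add: field_simps power2_eq_square)
  also have "\<dots> = - H * v * (1 - \<kappa>) / (\<kappa> * lor v * thermal v) + 1 / (v * (lor v)\<^sup>2)"
    using pos v kappa by (simp add: s2)
  also have "\<dots> = - (H * (1 - \<kappa>) * v\<^sup>2 - \<kappa> * thermal v / lor v) / (\<kappa> * (v * thermal v * lor v))"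
    using pos v kappa by (simp add: field_simps power2_eq_square)
  also have "H * (1 - \<kappa>) * v\<^sup>2 - \<kappa> * thermal v / lor v = mach_excess v"
    using pos by (simp add: mach_excess_def thermal_def field_simps)
  finally show ?thesis .
qed

lemma impulse_deriv:
  assumes v: "0 < v" "v < vmax"
  shows "(impulse has_real_derivative mach_excess v / v\<^sup>2) (at v)"
proof -
  note pos = thermal_pos[OF less_imp_le[OF v(1)] v(2)]
  have s2: "(lor v)\<^sup>2 = 1 - v\<^sup>2"
    using pos v by (simp add: lor_power2)
  have "(impulse has_real_derivative
      H + (\<kappa> * ((- v / lor v) * thermal v + (- H * v / lor v) * lor v) * v
        - \<kappa> * (lor v * thermal v)) / (v * v)) (at v)"
    unfolding impulse_def[abs_def] using pos v
    by (auto intro!: derivative_eq_intros lor_deriv thermal_deriv)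
  also have "H + (\<kappa> * ((- v / lor v) * thermal v + (- H * v / lor v) * lor v) * v
        - \<kappa> * (lor v * thermal v)) / (v * v)
      = H + (- \<kappa> * H * v\<^sup>2 - \<kappa> * thermal v * (v\<^sup>2 + (lor v)\<^sup>2) / lor v) / v\<^sup>2"
    using pos v by (simp add: field_simps power2_eq_square)
  also have "\<dots> = mach_excess v / v\<^sup>2"
    using pos v by (simp add: s2 mach_excess_def thermal_def field_simps)
  finally show ?thesis .
qed

lemma mach_excess_less:
  assumes "0 \<le> x" "x < y" "y < 1"
  shows "mach_excess x < mach_excess y"
proof -
  have "x\<^sup>2 < y\<^sup>2"
    using assms by (simp add: power_strict_mono)
  then have "H * (1 - \<kappa>) * x\<^sup>2 < H * (1 - \<kappa>) * y\<^sup>2"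
    using kappa level by simp
  moreover have "\<kappa> / lor x < \<kappa> / lor y"
    using lor_less[OF assms(1,2)] lor_pos[of y] assms kappa by (intro divide_strict_left_mono) auto
  ultimately show ?thesis
    by (simp add: mach_excess_def)
qed

lemma ex_sonic: "\<exists>v. 0 < v \<and> v < vmax \<and> mach_excess v = 0"
proof -
  have 0: "mach_excess 0 < 0"
    using kappa level by (simp add: mach_excess_def lor_def)
  have 1: "mach_excess vmax > 0"
    using kappa level vmax by (simp add: mach_excess_def)
  have "continuous_on {0..vmax} mach_excess"
    unfolding mach_excess_def[abs_def] lor_def using vmax
    by (intro continuous_intros) (auto simp: power2_eq_1_iff)
  then obtain v where "0 \<le> v" "v \<le> vmax" "mach_excess v = 0"
    using IVT'[of mach_excess 0 0 vmax] 0 1 vmax by auto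
  then show ?thesis
    using 0 1 by (intro exI[of _ v]) (auto simp: less_le)
qed

definition sonic :: real where
  "sonic = (SOME v. 0 < v \<and> v < vmax \<and> mach_excess v = 0)"

lemma sonic: "0 < sonic" "sonic < vmax" "mach_excess sonic = 0"
  using someI_ex[OF ex_sonic] by (auto simp: sonic_def)

lemma mach_excess_neg: "0 \<le> v \<Longrightarrow> v < sonic \<Longrightarrow> mach_excess v < 0"
  using mach_excess_less[of v sonic] sonic vmax by simp

lemma mach_excess_pos: "sonic < v \<Longrightarrow> v < 1 \<Longrightarrow> 0 < mach_excess v"
  using mach_excess_less[of sonic v] sonic by simp

text \<open>
  The left-hand side of the inequality is the squared sound speed in units of \<open>c\<^sup>2\<close>; compare
  \<open>sound_speed_power2\<close> below.
\<close>

lemma supersonic_iff: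
  assumes "0 < v" "v < vmax"
  shows "sonic < v \<longleftrightarrow> (\<gamma> - 1) * thermal v / (1 + thermal v) < v\<^sup>2"
proof -
  note pos = thermal_pos[OF less_imp_le[OF assms(1)] assms(2)]
  have "sonic < v \<longleftrightarrow> 0 < mach_excess v"
    using mach_excess_pos[of v] mach_excess_neg[of v] sonic pos assms
    by (cases v sonic rule: linorder_cases) auto
  also have "mach_excess v = (1 - \<kappa>) / lor v * ((1 + thermal v) * v\<^sup>2 - (\<gamma> - 1) * thermal v)"
  proof -
    have g: "\<kappa> = (1 - \<kappa>) * (\<gamma> - 1)"
      using gamma by (simp add: \<kappa>_def field_simps)
    have "mach_excess v = (1 - \<kappa>) / lor v * ((1 + thermal v) * v\<^sup>2) - \<kappa> * thermal v / lor v"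
      using pos by (simp add: mach_excess_def thermal_def field_simps)
    also have "\<kappa> * thermal v / lor v = (1 - \<kappa>) / lor v * ((\<gamma> - 1) * thermal v)"
      by (subst g) simp
    finally show ?thesis
      by (simp add: right_diff_distrib)
  qed
  also have "0 < \<dots> \<longleftrightarrow> (\<gamma> - 1) * thermal v < (1 + thermal v) * v\<^sup>2"
    using pos kappa by (simp add: zero_less_mult_iff zero_less_divide_iff)
  also have "\<dots> \<longleftrightarrow> (\<gamma> - 1) * thermal v / (1 + thermal v) < v\<^sup>2"
    using pos by (simp add: divide_less_eq mult.commute)
  finally show ?thesis .
qed

lemma log_flux_cont: "0 < v \<Longrightarrow> v < vmax \<Longrightarrow> isCont log_flux v"
  by (rule DERIV_isCont[OF log_flux_deriv])

lemma impulse_cont: "0 < v \<Longrightarrow> v < vmax \<Longrightarrow> isCont impulse v"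
  by (rule DERIV_isCont[OF impulse_deriv])

lemma log_flux_less_sub:
  assumes "0 < x" "x < y" "y \<le> sonic"
  shows "log_flux x < log_flux y"
proof (rule DERIV_pos_imp_increasing_open[OF assms(2)])
  fix v assume v: "x < v" "v < y"
  then have "0 < - mach_excess v / (\<kappa> * (v * thermal v * lor v))"
    using assms sonic thermal_pos[of v] mach_excess_neg[of v] kappa
    by (intro divide_pos_pos mult_pos_pos) auto
  then show "\<exists>d. DERIV log_flux v :> d \<and> 0 < d"
    using log_flux_deriv[of v] v assms sonic by auto
qed (use assms sonic in \<open>auto intro!: continuous_at_imp_continuous_on log_flux_cont\<close>)

lemma log_flux_less_sup:
  assumes "sonic \<le> x" "x < y" "y < vmax"
  shows "log_flux y < log_flux x"
proof (rule DERIV_neg_imp_decreasing_open[OF assms(2)])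
  fix v assume v: "x < v" "v < y"
  then have "0 < mach_excess v / (\<kappa> * (v * thermal v * lor v))"
    using assms sonic vmax thermal_pos[of v] mach_excess_pos[of v] kappa
    by (intro divide_pos_pos mult_pos_pos) auto
  then show "\<exists>d. DERIV log_flux v :> d \<and> d < 0"
    using log_flux_deriv[of v] v assms sonic by (auto simp: field_simps)
qed (use assms sonic in \<open>auto intro!: continuous_at_imp_continuous_on log_flux_cont\<close>)

lemma impulse_less_sub:
  assumes "0 < x" "x < y" "y \<le> sonic"
  shows "impulse y < impulse x"
proof (rule DERIV_neg_imp_decreasing_open[OF assms(2)])
  fix v assume v: "x < v" "v < y"
  then have "mach_excess v / v\<^sup>2 < 0"
    using assms mach_excess_neg[of v] by (intro divide_neg_pos) auto
  then show "\<exists>d. DERIV impulse v :> d \<and> d < 0"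
    using impulse_deriv[of v] v assms sonic by auto
qed (use assms sonic in \<open>auto intro!: continuous_at_imp_continuous_on impulse_cont\<close>)

lemma impulse_less_sup:
  assumes "sonic \<le> x" "x < y" "y < vmax"
  shows "impulse x < impulse y"
proof (rule DERIV_pos_imp_increasing_open[OF assms(2)])
  fix v assume v: "x < v" "v < y"
  then have "0 < mach_excess v / v\<^sup>2"
    using assms sonic vmax mach_excess_pos[of v] by (intro divide_pos_pos) auto
  then show "\<exists>d. DERIV impulse v :> d \<and> 0 < d"
    using impulse_deriv[of v] v assms sonic by auto
qed (use assms sonic in \<open>auto intro!: continuous_at_imp_continuous_on impulse_cont\<close>)

lemma log_flux_le_sonic:
  assumes "0 < v" "v < vmax"
  shows "log_flux v \<le> log_flux sonic"
  using log_flux_less_sub[of v sonic] log_flux_less_sup[of sonic v] assms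
  by (cases v sonic rule: linorder_cases) auto

lemma log_flux_less_sub_iff:
  assumes "0 < x" "x \<le> sonic" "0 < y" "y \<le> sonic"
  shows "log_flux x < log_flux y \<longleftrightarrow> x < y"
  using assms log_flux_less_sub[of x y] log_flux_less_sub[of y x]
  by (cases x y rule: linorder_cases) auto

section \<open>The shock polar\<close>

text \<open>
  The derivative of the combination is \<open>M' (g\<^sub>* - g)\<close> with \<open>g = v / (w s)\<close> increasing.  Below the
  sonic speed \<open>M' < 0\<close> and \<open>g < g\<^sub>*\<close>, above it both signs are reversed, so the product is negative
  away from the sonic speed.
\<close>

lemma combined_less:
  assumes "0 < x" "x < y" "y < vmax"
  defines "g \<equiv> sonic / (thermal sonic * lor sonic)"
  shows "\<kappa> * log_flux y + g * impulse y < \<kappa> * log_flux x + g * impulse x"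
proof -
  let ?f = "\<lambda>v. \<kappa> * log_flux v + g * impulse v"
  let ?g = "\<lambda>v. v / (thermal v * lor v)"
  have g_less: "?g v < ?g v'" if "0 < v" "v < v'" "v' < vmax" for v v'
  proof -
    note a = thermal_pos[of v] thermal_pos[of v'] lor_less[of v v']
    have "thermal v' * lor v' < thermal v * lor v"
      using a that level by (intro mult_strict_mono) (auto simp: thermal_def)
    then show ?thesis
      using a that by (intro frac_less) auto
  qed
  have der: "DERIV ?f v :> mach_excess v / v\<^sup>2 * (g - ?g v)" if v: "0 < v" "v < vmax" for v
  proof -
    have "DERIV ?f v :> \<kappa> * (- mach_excess v / (\<kappa> * (v * thermal v * lor v))) + g * (mach_excess v / v\<^sup>2)"
      by (intro DERIV_add DERIV_cmult log_flux_deriv impulse_deriv v)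
    also have "\<kappa> * (- mach_excess v / (\<kappa> * (v * thermal v * lor v))) + g * (mach_excess v / v\<^sup>2)
        = mach_excess v / v\<^sup>2 * (g - ?g v)"
      using kappa v by (simp add: right_diff_distrib power2_eq_square mult_ac)
    finally show ?thesis .
  qed
  have cont: "continuous_on {a..b} ?f" if "0 < a" "b < vmax" for a b
    using that by (intro continuous_at_imp_continuous_on) (auto intro!: DERIV_isCont der)
  have neg: "mach_excess v / v\<^sup>2 * (g - ?g v) < 0" if v: "0 < v" "v < vmax" "v \<noteq> sonic" for v
  proof (cases "v < sonic")
    case True
    then have "mach_excess v / v\<^sup>2 < 0"
      using v mach_excess_neg[of v] by (intro divide_neg_pos) auto
    then show ?thesis
      using g_less[of v sonic] True v sonic by (intro mult_neg_pos) (auto simp: g_def)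
  next
    case False
    then have "0 < mach_excess v / v\<^sup>2"
      using v vmax mach_excess_pos[of v] by (intro divide_pos_pos) auto
    then show ?thesis
      using g_less[of sonic v] False v sonic by (intro mult_pos_neg) (auto simp: g_def)
  qed
  have piece: "?f b < ?f a" if "0 < a" "a < b" "b < vmax" "b \<le> sonic \<or> sonic \<le> a" for a b
  proof (rule DERIV_neg_imp_decreasing_open[OF that(2)])
    fix v assume "a < v" "v < b"
    then show "\<exists>d. DERIV ?f v :> d \<and> d < 0"
      using der[of v] neg[of v] that by (intro exI conjI) auto
  qed (use that cont in auto)
  show ?thesis
  proof (cases "x < sonic \<and> sonic < y")
    case True
    then show ?thesis
      using piece[of x sonic] piece[of sonic y] assms sonic by fastforce
  next
    case False
    then show ?thesis
      using piece[of x y] assms by auto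
  qed
qed

text \<open>
  On a pair of speeds with equal impulse the combination differs only in its \<open>log_flux\<close> part.
\<close>

lemma entropy_increases:
  assumes "0 < x" "x < y" "y < vmax" "impulse x = impulse y"
  shows "log_flux y < log_flux x"
  using combined_less[OF assms(1-3)] assms(4) kappa by simp

text \<open>
  A stronger shock joins speeds \<open>x' < x\<close> and \<open>y < y'\<close> on either side of a weaker one.  The monotone
  combination is compared at \<open>x', x\<close> and at \<open>y, y'\<close>; the impulse terms cancel in the sum.
\<close>

lemma entropy_jump_less:
  assumes "0 < x'" "x' < x" "x < y" "y < y'" "y' < vmax" "impulse x = impulse y" "impulse x' = impulse y'"
  shows "log_flux x - log_flux y < log_flux x' - log_flux y'"
proof -
  have "\<kappa> * (log_flux x - log_flux y) < \<kappa> * (log_flux x' - log_flux y')"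
    using combined_less[of x' x] combined_less[of y y'] assms by (simp add: algebra_simps)
  then show ?thesis
    using kappa by simp
qed

section \<open>Subsonic and supersonic branches\<close>

text \<open>
  This bound isolates the two terms that drive \<open>log_flux\<close> to minus infinity: \<open>ln v\<close> at zero speed and
  \<open>ln (thermal v)\<close> at \<open>vmax\<close>.  It makes both branches of the inverse defined on a whole half line.
\<close>

lemma log_flux_bound:
  assumes "0 < v" "v < vmax"
  shows "log_flux v \<le> ln (thermal v) / (\<gamma> - 1) + ln v + ln H"
proof -
  have "1 / H < lor v"
    using lor_less[of v vmax] assms vmax by simp
  then have "ln (1 / H) \<le> ln (lor v)"
    using level by (intro ln_mono) auto
  then show ?thesis
    using level by (simp add: log_flux_def ln_div)
qed

lemma ex_log_flux_sub:
  assumes "t < log_flux sonic"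
  shows "\<exists>v. 0 < v \<and> v < sonic \<and> log_flux v = t"
proof -
  \<comment> \<open>Small enough for the bound on \<open>log_flux a\<close> to be at most \<open>t\<close>.\<close>
  define a where "a = min (sonic / 2) (exp (t - ln (H - 1) / (\<gamma> - 1) - ln H))"
  have a: "0 < a" "a < sonic" "ln a \<le> t - ln (H - 1) / (\<gamma> - 1) - ln H"
  proof -
    show a: "0 < a" "a < sonic"
      using sonic by (auto simp: a_def min_less_iff_disj)
    have "ln a \<le> ln (exp (t - ln (H - 1) / (\<gamma> - 1) - ln H))"
      using a by (intro ln_mono) (auto simp: a_def)
    then show "ln a \<le> t - ln (H - 1) / (\<gamma> - 1) - ln H"
      by simp
  qed
  have "thermal a \<le> H - 1" "0 < thermal a"
    using a sonic thermal_pos[of a] level by (auto simp: thermal_def lor_def)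
  then have "ln (thermal a) / (\<gamma> - 1) \<le> ln (H - 1) / (\<gamma> - 1)"
    using gamma by (intro divide_right_mono ln_mono) auto
  then have "log_flux a \<le> t"
    using log_flux_bound[of a] a sonic by simp
  moreover have "continuous_on {a..sonic} log_flux"
    using a sonic by (intro continuous_at_imp_continuous_on) (auto intro!: log_flux_cont)
  ultimately obtain v where "a \<le> v" "v \<le> sonic" "log_flux v = t"
    using IVT'[of log_flux a t sonic] assms a by auto
  then show ?thesis
    using a assms by (intro exI[of _ v]) (auto simp: less_le)
qed

lemma ex_log_flux_sup:
  assumes "t < log_flux sonic"
  shows "\<exists>v. sonic < v \<and> v < vmax \<and> log_flux v = t"
proof -
  \<comment> \<open>The thermal ratio at which the bound on \<open>log_flux\<close> drops to \<open>t\<close>; \<open>ln b \<le> 0\<close> is discarded.\<close>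
  define e where "e = min (thermal sonic / 2) (exp ((\<gamma> - 1) * (t - ln H)))"
  have e: "0 < e" "e < thermal sonic" "ln e \<le> (\<gamma> - 1) * (t - ln H)"
  proof -
    show e: "0 < e" "e < thermal sonic"
      using sonic thermal_pos[of sonic] by (auto simp: e_def min_less_iff_disj)
    have "ln e \<le> ln (exp ((\<gamma> - 1) * (t - ln H)))"
      using e by (intro ln_mono) (auto simp: e_def)
    then show "ln e \<le> (\<gamma> - 1) * (t - ln H)"
      by simp
  qed
  have "thermal vmax = 0"
    using vmax level by (simp add: thermal_def)
  moreover have "continuous_on {sonic..vmax} thermal"
    unfolding thermal_def[abs_def] lor_def by (intro continuous_intros)
  ultimately obtain b where b: "sonic \<le> b" "b \<le> vmax" "thermal b = e"
    using IVT2'[of thermal vmax e sonic] e sonic by auto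
  then have b': "b < vmax"
    using e \<open>thermal vmax = 0\<close> by (auto simp: less_le)
  have "ln b \<le> 0"
    using b sonic vmax by simp
  moreover have "ln e / (\<gamma> - 1) \<le> t - ln H"
    using e gamma by (simp add: field_simps)
  ultimately have "log_flux b \<le> t"
    using log_flux_bound[of b] b b' sonic by (simp del: ln_le_zero_iff)
  moreover have "continuous_on {sonic..b} log_flux"
    using b' sonic by (intro continuous_at_imp_continuous_on) (auto intro!: log_flux_cont)
  ultimately obtain v where "sonic \<le> v" "v \<le> b" "log_flux v = t"
    using IVT2'[of log_flux b t sonic] assms b by auto
  then show ?thesis
    using b' assms by (intro exI[of _ v]) (auto simp: less_le)
qed

text \<open>
  The impulse is at least \<open>\<kappa> (H - 1) / v\<close>, hence unbounded near zero speed, so every value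
  above the minimum is attained by a subsonic speed.
\<close>

lemma ex_impulse_sub:
  assumes "impulse sonic < m"
  shows "\<exists>v. 0 < v \<and> v < sonic \<and> impulse v = m"
proof -
  have "0 < impulse sonic"
    unfolding impulse_def using sonic thermal_pos[of sonic] kappa level
    by (intro add_pos_pos divide_pos_pos mult_pos_pos) auto
  then have m: "0 < m"
    using assms by simp
  define a where "a = min (sonic / 2) (\<kappa> * (H - 1) / m)"
  have a: "0 < a" "a < sonic" "a \<le> \<kappa> * (H - 1) / m"
    using sonic m kappa level by (auto simp: a_def min_less_iff_disj)
  have "m \<le> \<kappa> * (H - 1) / a"
    using a m by (simp add: field_simps)
  also have "\<dots> \<le> \<kappa> * (H - lor a) / a"
    using a kappa by (intro divide_right_mono mult_left_mono) (auto simp: lor_def)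
  also have "\<dots> \<le> H * (1 - \<kappa>) * a + \<kappa> * (H - lor a) / a"
    using a kappa level by simp
  also have "\<dots> = impulse a"
  proof -
    have "lor a * thermal a = H * (1 - a\<^sup>2) - lor a"
      using lor_power2[of a, symmetric] a sonic vmax
      by (simp add: thermal_def right_diff_distrib power2_eq_square)
    then have "impulse a = H * a + \<kappa> * (H * (1 - a\<^sup>2) - lor a) / a"
      by (simp only: impulse_def)
    then show ?thesis
      using a by (simp add: field_simps power2_eq_square)
  qed
  finally have "m \<le> impulse a" .
  moreover have "continuous_on {a..sonic} impulse"
    using a sonic by (intro continuous_at_imp_continuous_on) (auto intro!: impulse_cont)
  ultimately obtain v where "a \<le> v" "v \<le> sonic" "impulse v = m"
    using IVT2'[of impulse sonic m a] assms a by auto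
  then show ?thesis
    using a assms by (intro exI[of _ v]) (auto simp: less_le)
qed

definition sub_branch :: "real \<Rightarrow> real" where
  "sub_branch = inv_into {0<..<sonic} log_flux"

definition sup_branch :: "real \<Rightarrow> real" where
  "sup_branch = inv_into {sonic<..<vmax} log_flux"

text \<open>
  The speed behind a shock whose upstream speed is \<open>v\<close>.
\<close>

definition post_shock :: "real \<Rightarrow> real" where
  "post_shock v = inv_into {0<..<sonic} impulse (impulse v)"

lemma inj_sub: "inj_on log_flux {0<..<sonic}"
  by (rule linorder_inj_onI) (use log_flux_less_sub in force)+

lemma inj_sup: "inj_on log_flux {sonic<..<vmax}"
  by (rule linorder_inj_onI) (auto, metis less_imp_le less_irrefl log_flux_less_sup)

lemma inj_impulse: "inj_on impulse {0<..<sonic}"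
  by (rule linorder_inj_onI) (use impulse_less_sub in force)+

lemma sub_branch_log_flux: "0 < v \<Longrightarrow> v < sonic \<Longrightarrow> sub_branch (log_flux v) = v"
  unfolding sub_branch_def by (rule inv_into_f_f[OF inj_sub]) simp

lemma sup_branch_log_flux: "sonic < v \<Longrightarrow> v < vmax \<Longrightarrow> sup_branch (log_flux v) = v"
  unfolding sup_branch_def by (rule inv_into_f_f[OF inj_sup]) simp

lemma sub_branch:
  assumes "t < log_flux sonic"
  shows "0 < sub_branch t" "sub_branch t < sonic" "sub_branch t < vmax" "log_flux (sub_branch t) = t"
  using ex_log_flux_sub[OF assms] sub_branch_log_flux sonic by auto

lemma sup_branch:
  assumes "t < log_flux sonic"
  shows "sonic < sup_branch t" "0 < sup_branch t" "sup_branch t < vmax" "log_flux (sup_branch t) = t"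
  using ex_log_flux_sup[OF assms] sup_branch_log_flux sonic by auto

lemma sub_branch_deriv:
  assumes "t < log_flux sonic"
  defines "v \<equiv> sub_branch t"
  shows "(sub_branch has_real_derivative inverse (- mach_excess v / (\<kappa> * (v * thermal v * lor v)))) (at t)"
proof -
  note b = sub_branch[OF assms(1), folded v_def]
  have "(inv_into {0<..<sonic} log_flux has_real_derivative
      inverse (- mach_excess v / (\<kappa> * (v * thermal v * lor v)))) (at (log_flux v))"
    using b sonic thermal_pos[of v] mach_excess_neg[of v] kappa
    by (intro DERIV_inv_into inj_sub log_flux_deriv) auto
  then show ?thesis
    using b by (simp add: sub_branch_def)
qed

lemma sup_branch_deriv:
  assumes "t < log_flux sonic"
  defines "v \<equiv> sup_branch t"
  shows "(sup_branch has_real_derivative inverse (- mach_excess v / (\<kappa> * (v * thermal v * lor v)))) (at t)"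
proof -
  note b = sup_branch[OF assms(1), folded v_def]
  have "(inv_into {sonic<..<vmax} log_flux has_real_derivative
      inverse (- mach_excess v / (\<kappa> * (v * thermal v * lor v)))) (at (log_flux v))"
    using b sonic thermal_pos[of v] mach_excess_pos[of v] kappa
    by (intro DERIV_inv_into inj_sup log_flux_deriv) auto
  then show ?thesis
    using b by (simp add: sup_branch_def)
qed

lemma post_shock:
  assumes "sonic < v" "v < vmax"
  shows "0 < post_shock v" "post_shock v < sonic" "post_shock v < vmax" "impulse (post_shock v) = impulse v"
proof -
  obtain x where x: "0 < x" "x < sonic" "impulse x = impulse v"
    using ex_impulse_sub impulse_less_sup[of sonic v] assms by auto
  have "post_shock v = x"
    unfolding post_shock_def x(3)[symmetric] by (rule inv_into_f_f[OF inj_impulse]) (use x in simp)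
  then show "0 < post_shock v" "post_shock v < sonic" "post_shock v < vmax" "impulse (post_shock v) = impulse v"
    using x sonic by auto
qed

lemma post_shock_unique:
  assumes "sonic < v" "v < vmax" "0 < x" "x < vmax" "impulse x = impulse v" "x \<noteq> v"
  shows "x = post_shock v"
proof -
  have "\<not> sonic \<le> x"
    using impulse_less_sup[of x v] impulse_less_sup[of v x] assms by force
  then have "x \<in> {0<..<sonic}"
    using assms by simp
  then show ?thesis
    unfolding post_shock_def assms(5)[symmetric] by (simp add: inv_into_f_f[OF inj_impulse])
qed

lemma post_shock_less:
  assumes "sonic < v" "v < v'" "v' < vmax"
  shows "post_shock v' < post_shock v"
proof -
  have "impulse (post_shock v) < impulse (post_shock v')"
    using impulse_less_sup[of v v'] post_shock[of v] post_shock[of v'] assms by simp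
  then have "\<not> post_shock v \<le> post_shock v'"
    using impulse_less_sub[of "post_shock v" "post_shock v'"] post_shock[of v] post_shock[of v'] assms by force
  then show ?thesis
    by simp
qed

lemma post_shock_cont:
  assumes "sonic < v" "v < vmax"
  shows "isCont post_shock v"
proof -
  let ?x = "post_shock v"
  note b = post_shock[OF assms]
  have "(inv_into {0<..<sonic} impulse has_real_derivative
      inverse (mach_excess ?x / ?x\<^sup>2)) (at (impulse ?x))"
    using b sonic mach_excess_neg[of ?x]
    by (intro DERIV_inv_into inj_impulse impulse_deriv) auto
  then have "isCont (inv_into {0<..<sonic} impulse) (impulse v)"
    using b by (simp add: DERIV_isCont)
  then show ?thesis
    unfolding post_shock_def[abs_def]
    using isCont_o2[OF impulse_cont[of v]] assms sonic by simp
qed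

text \<open>
  The jump of the entropy across the shock, in units of \<open>R\<close>.
\<close>

definition entropy_gain :: "real \<Rightarrow> real" where
  "entropy_gain v = log_flux (post_shock v) - log_flux v"

lemma entropy_gain_pos: "sonic < v \<Longrightarrow> v < vmax \<Longrightarrow> 0 < entropy_gain v"
  using entropy_increases[of "post_shock v" v] post_shock[of v] by (simp add: entropy_gain_def)

text \<open>
  A faster upstream flow is slowed down to a smaller speed, so the two pairs of speeds are nested.
\<close>

lemma entropy_gain_less:
  assumes "sonic < v" "v < v'" "v' < vmax"
  shows "entropy_gain v < entropy_gain v'"
  unfolding entropy_gain_def
  using post_shock_less[OF assms] post_shock[of v] post_shock[of v'] assms by (intro entropy_jump_less) auto

lemma entropy_gain_cont:
  assumes "sonic < v" "v < vmax"
  shows "isCont entropy_gain v"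
  unfolding entropy_gain_def[abs_def]
  using assms post_shock[of v] sonic
  by (intro continuous_diff isCont_o2[OF post_shock_cont] log_flux_cont) auto

end

section \<open>States of a polytropic gas\<close>

lemma sqrt_speed:
  assumes "0 < c"
  shows "sqrt (c\<^sup>2 - (c * v)\<^sup>2) = c * lor v"
proof -
  have "c\<^sup>2 - (c * v)\<^sup>2 = c\<^sup>2 * (1 - v\<^sup>2)"
    by (simp add: algebra_simps power_mult_distrib)
  then show ?thesis
    using assms by (simp add: lor_def real_sqrt_mult)
qed

lemma speed_power2:
  assumes "0 < c" "\<bar>v\<bar> < 1"
  shows "c\<^sup>2 - (c * v)\<^sup>2 = c\<^sup>2 * (lor v)\<^sup>2"
  using assms by (simp add: lor_power2 algebra_simps power_mult_distrib)

locale polytropic_gas =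
  fixes c \<gamma> R A :: real
  assumes c_pos: "0 < c" and gamma_gt_1: "1 < \<gamma>" and R_pos: "0 < R" and A_pos: "0 < A"
begin

abbreviation "p \<equiv> pressure \<gamma> R A"

text \<open>
  The thermal part of the specific enthalpy, \<open>(p + \<rho> c\<^sup>2) / (n c\<^sup>2) - 1\<close>, as \<open>enthalpy_eq\<close> shows.
\<close>

definition heat_ratio :: "real \<Rightarrow> real \<Rightarrow> real" where
  "heat_ratio n S = \<gamma> / (\<gamma> - 1) * p n S / (n * c\<^sup>2)"

definition offset :: real where
  "offset = ln (\<gamma> / ((\<gamma> - 1) * c\<^sup>2))"

lemma pressure_pos: "0 < n \<Longrightarrow> 0 < p n S"
  using A_pos by (simp add: pressure_def)

lemma heat_ratio_pos: "0 < n \<Longrightarrow> 0 < heat_ratio n S"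
  using gamma_gt_1 c_pos by (simp add: heat_ratio_def pressure_pos)

lemma pressure_eq: "0 < n \<Longrightarrow> p n S = (\<gamma> - 1) / \<gamma> * c\<^sup>2 * n * heat_ratio n S"
  using gamma_gt_1 c_pos by (simp add: heat_ratio_def)

lemma enthalpy_eq:
  assumes "0 < n"
  shows "p n S + energy_density c \<gamma> R A n S * c\<^sup>2 = n * c\<^sup>2 * (1 + heat_ratio n S)"
proof -
  have "p n S + energy_density c \<gamma> R A n S * c\<^sup>2 = n * c\<^sup>2 + (1 + 1 / (\<gamma> - 1)) * p n S"
    using assms c_pos gamma_gt_1
    by (simp add: energy_density_def internal_energy_def distrib_left distrib_right)
  also have "1 + 1 / (\<gamma> - 1) = \<gamma> / (\<gamma> - 1)"
    using gamma_gt_1 by (simp add: field_simps)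
  finally show ?thesis
    using assms c_pos by (simp add: heat_ratio_def distrib_left)
qed

lemma mass_flux_eq: "mass_flux c (c * v) n = n * v / lor v"
  using c_pos by (simp add: mass_flux_def sqrt_speed)

lemma bernoulli_eq:
  assumes "0 < n"
  shows "bernoulli c \<gamma> R A (c * v) n S = c * ((1 + heat_ratio n S) / lor v)"
  unfolding bernoulli_def enthalpy_eq[OF assms] sqrt_speed[OF c_pos]
  using assms c_pos by (simp add: power2_eq_square)

lemma momentum_flux_eq:
  assumes "0 < n" "\<bar>v\<bar> < 1"
  shows "momentum_flux c \<gamma> R A (c * v) n S =
    c\<^sup>2 * (n * (1 + heat_ratio n S) * v\<^sup>2 / (lor v)\<^sup>2 + (\<gamma> - 1) / \<gamma> * n * heat_ratio n S)"
proof -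
  have "n * c\<^sup>2 * h / (c\<^sup>2 * (lor v)\<^sup>2) * (c * v)\<^sup>2 = c\<^sup>2 * (n * h * v\<^sup>2 / (lor v)\<^sup>2)" for h
    using c_pos by (simp add: power_mult_distrib)
  then show ?thesis
    unfolding momentum_flux_def enthalpy_eq[OF assms(1)] speed_power2[OF c_pos assms(2)]
    by (simp only: pressure_eq[OF assms(1)]) (simp add: distrib_left)
qed

lemma ln_pressure: "0 < n \<Longrightarrow> ln (p n S) = ln A + (\<gamma> - 1) * S / R + \<gamma> * ln n"
  using A_pos by (simp add: pressure_def heat_capacity_def ln_mult ln_powr mult.commute)

lemma ln_heat_ratio:
  assumes "0 < n"
  shows "ln (heat_ratio n S) = offset + ln A + (\<gamma> - 1) * S / R + (\<gamma> - 1) * ln n"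
proof -
  have "heat_ratio n S = \<gamma> / ((\<gamma> - 1) * c\<^sup>2) * p n S / n"
    by (simp add: heat_ratio_def)
  also have "ln \<dots> = offset + ln (p n S) - ln n"
    using assms gamma_gt_1 c_pos pressure_pos[OF assms, of S]
    by (auto simp: offset_def ln_mult ln_div)
  finally show ?thesis
    using assms by (simp add: ln_pressure algebra_simps)
qed

lemma heat_ratio_eq_iff:
  assumes "0 < n" "0 < x"
  shows "heat_ratio n S = x \<longleftrightarrow> S = R * (ln x / (\<gamma> - 1) - ln n - (offset + ln A) / (\<gamma> - 1))"
proof -
  have "heat_ratio n S = x \<longleftrightarrow> ln (heat_ratio n S) = ln x"
    using assms heat_ratio_pos by simp
  also have "\<dots> \<longleftrightarrow> (\<gamma> - 1) * S / R = ln x - (\<gamma> - 1) * ln n - (offset + ln A)"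
    using assms by (auto simp: ln_heat_ratio)
  also have "\<dots> \<longleftrightarrow> S = R / (\<gamma> - 1) * (ln x - (\<gamma> - 1) * ln n - (offset + ln A))" 
  proof -
    have "(\<gamma> - 1) * S / R = e \<longleftrightarrow> S = R / (\<gamma> - 1) * e" for e
    proof -
      have "(\<gamma> - 1) * S / R = e \<longleftrightarrow> (\<gamma> - 1) * S = R * e"
        using R_pos by (auto simp: field_simps)
      also have "\<dots> \<longleftrightarrow> S = R * e / (\<gamma> - 1)"
        using gamma_gt_1 eq_divide_eq[of S "R * e" "\<gamma> - 1"] by (simp add: mult.commute)
      finally show ?thesis by simp
    qed
    then show ?thesis .
  qed
  also have "R / (\<gamma> - 1) * (ln x - (\<gamma> - 1) * ln n - (offset + ln A)) = R * (ln x / (\<gamma> - 1) - ln n - (offset + ln A) / (\<gamma> - 1))"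
    using gamma_gt_1 by (simp add: diff_divide_distrib right_diff_distrib)
  finally show ?thesis .
qed

text \<open>
  The momentum equation provides derivatives of the speed and the pressure only.  With the Bernoulli
  law the speed determines \<open>heat_ratio\<close>, so this form of the entropy can be differentiated directly,
  with the density eliminated.
\<close>

lemma entropy_of_pressure:
  assumes "0 < n"
  shows "S = R * (\<gamma> / (\<gamma> - 1) * ln (heat_ratio n S) - ln (p n S) - (ln A + \<gamma> * offset) / (\<gamma> - 1))"
proof -
  define x where "x = 1 / (\<gamma> - 1)"
  define s where "s = S / R"
  have "x * (\<gamma> - 1) = 1"
    using gamma_gt_1 by (simp add: x_def)
  then have "\<gamma> * x * (offset + ln A + (\<gamma> - 1) * s + (\<gamma> - 1) * ln n)
      - (ln A + (\<gamma> - 1) * s + \<gamma> * ln n) - (ln A + \<gamma> * offset) * x = s"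
    by algebra
  then show ?thesis
    unfolding ln_heat_ratio[OF assms] ln_pressure[OF assms]
    using R_pos by (simp add: x_def s_def)
qed

lemma pressure_of_entropy:
  assumes "0 < n"
  shows "p n S = exp (\<gamma> / (\<gamma> - 1) * ln (heat_ratio n S) - S / R - (ln A + \<gamma> * offset) / (\<gamma> - 1))"
proof -
  have "p n S = exp (ln (p n S))"
    using pressure_pos[OF assms] by simp
  also have "ln (p n S) = \<gamma> / (\<gamma> - 1) * ln (heat_ratio n S) - S / R - (ln A + \<gamma> * offset) / (\<gamma> - 1)"
    using entropy_of_pressure[OF assms, of S] R_pos by (simp add: field_simps)
  finally show ?thesis .
qed

lemma pressure_deriv:
  assumes "0 < n"
  shows "((\<lambda>m. p m S) has_real_derivative (\<gamma> - 1) * c\<^sup>2 * heat_ratio n S) (at n)"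
proof -
  have "((\<lambda>m. p m S) has_real_derivative
      A * exp (S / heat_capacity \<gamma> R) * (\<gamma> * n powr (\<gamma> - 1))) (at n)"
    unfolding pressure_def using assms by (intro DERIV_cmult has_real_derivative_powr)
  also have "A * exp (S / heat_capacity \<gamma> R) * (\<gamma> * n powr (\<gamma> - 1)) = \<gamma> * p n S / n"
    using assms by (simp add: pressure_def powr_diff)
  also have "\<dots> = (\<gamma> - 1) * c\<^sup>2 * heat_ratio n S"
    using gamma_gt_1 c_pos by (simp add: heat_ratio_def)
  finally show ?thesis .
qed

lemma energy_density_deriv:
  assumes "0 < n"
  shows "((\<lambda>m. energy_density c \<gamma> R A m S) has_real_derivative 1 + heat_ratio n S) (at n)"
proof (rule has_field_derivative_transform_within_open)
  have "((\<lambda>m. m + p m S / ((\<gamma> - 1) * c\<^sup>2)) has_real_derivative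
      1 + (\<gamma> - 1) * c\<^sup>2 * heat_ratio n S / ((\<gamma> - 1) * c\<^sup>2)) (at n)"
    by (intro DERIV_add DERIV_ident DERIV_cdivide pressure_deriv assms)
  then show "((\<lambda>m. m + p m S / ((\<gamma> - 1) * c\<^sup>2)) has_real_derivative 1 + heat_ratio n S) (at n)"
    using gamma_gt_1 c_pos by simp
  show "x + p x S / ((\<gamma> - 1) * c\<^sup>2) = energy_density c \<gamma> R A x S" if "x \<in> {0<..}" for x
    using that by (simp add: energy_density_def internal_energy_def distrib_left)
qed (use assms in auto)

text \<open>
  The density \<open>\<rho>\<close> is an increasing function of \<open>n\<close> with derivative \<open>1 + w\<close>, and \<open>\<partial>p/\<partial>n\<close> is
  \<open>(\<gamma> - 1) c\<^sup>2 w\<close>; the chain rule for the inverse function gives the quotient.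
\<close>

lemma sound_speed_power2:
  assumes "0 < n"
  shows "(sound_speed c \<gamma> R A n S)\<^sup>2 = (\<gamma> - 1) * c\<^sup>2 * heat_ratio n S / (1 + heat_ratio n S)"
proof -
  let ?\<rho> = "\<lambda>m. energy_density c \<gamma> R A m S"
  let ?w = "heat_ratio n S"
  have less: "?\<rho> x < ?\<rho> y" if "0 < x" "x < y" for x y
  proof (rule DERIV_pos_imp_increasing_open[OF that(2)])
    show "\<exists>d. DERIV ?\<rho> m :> d \<and> 0 < d" if "x < m" for m
      using energy_density_deriv[of m S] heat_ratio_pos[of m S] that \<open>0 < x\<close>
      by (intro exI[of _ "1 + heat_ratio m S"]) auto
    show "continuous_on {x..y} ?\<rho>"
      using that by (intro continuous_at_imp_continuous_on ballI DERIV_isCont[OF energy_density_deriv]) auto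
  qed
  have inj: "inj_on ?\<rho> {0<..}"
    by (rule linorder_inj_onI) (auto, metis less less_irrefl)
  have "(inv_into {0<..} ?\<rho> has_real_derivative inverse (1 + ?w)) (at (?\<rho> n))"
    using assms heat_ratio_pos[OF assms, of S]
    by (intro DERIV_inv_into[where f' = "\<lambda>n. 1 + heat_ratio n S"] inj energy_density_deriv) auto
  moreover have "((\<lambda>m. p m S) has_real_derivative (\<gamma> - 1) * c\<^sup>2 * ?w)
      (at (inv_into {0<..} ?\<rho> (?\<rho> n)))"
    using pressure_deriv[OF assms] assms by (simp add: inv_into_f_f[OF inj])
  ultimately have "((\<lambda>\<rho>. pressure_of_energy_density c \<gamma> R A \<rho> S) has_real_derivative
      (\<gamma> - 1) * c\<^sup>2 * ?w * inverse (1 + ?w)) (at (?\<rho> n))"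
    unfolding pressure_of_energy_density_def by (rule DERIV_chain2[rotated])
  moreover have "0 \<le> (\<gamma> - 1) * c\<^sup>2 * ?w * inverse (1 + ?w)"
    using gamma_gt_1 heat_ratio_pos[OF assms, of S] by simp
  ultimately show ?thesis
    by (simp add: sound_speed_def DERIV_imp_deriv divide_inverse)
qed

text \<open>
  With the derivative \<open>w' = - (1 + w) v v' / s\<^sup>2\<close> that the Bernoulli law prescribes, the momentum
  equation is \<open>p' = c\<^sup>2 n w'\<close>, which is the isentropic relation between pressure and enthalpy.
\<close>

lemma momentum_balance_iff:
  assumes "0 < n" "0 < h" "0 < l"
  shows "c * v * (c * v') + c\<^sup>2 * l\<^sup>2 / (n * c\<^sup>2 * h) * p' = 0 \<longleftrightarrow>
    p' = c\<^sup>2 * n * (- h * v * v' / l\<^sup>2)"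
  using assms c_pos by (auto simp: field_simps power2_eq_square)

lemma heat_ratio_deriv_of_level:
  assumes v: "(v has_real_derivative v') (at y within I)" "\<bar>v y\<bar> < 1"
    and w: "H * lor (v y) - 1 = w"
  shows "((\<lambda>x. H * lor (v x) - 1) has_real_derivative - (1 + w) * v y * v' / (lor (v y))\<^sup>2) (at y within I)"
proof -
  have "((\<lambda>x. H * lor (v x) - 1) has_real_derivative H * (- v y / lor (v y) * v')) (at y within I)"
    using v by (auto intro!: derivative_eq_intros DERIV_chain2[OF lor_deriv])
  also have "H * (- v y / lor (v y) * v') = - (H * lor (v y)) * v y * v' / (lor (v y))\<^sup>2"
    using lor_pos[OF v(2)] by (simp add: power2_eq_square)
  also have "H * lor (v y) = 1 + w"
    using w by simp
  finally show ?thesis .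
qed

text \<open>
  By \<open>entropy_of_pressure\<close> the derivative of \<open>S / R\<close> is \<open>\<gamma> / (\<gamma> - 1) * w' / w - p' / p\<close>, and both
  terms agree since \<open>p' = c\<^sup>2 n w'\<close> and \<open>p = (\<gamma> - 1) / \<gamma> * c\<^sup>2 n w\<close>.
\<close>

lemma entropy_stationary:
  assumes D: "y \<in> D"
    and state: "\<And>x. x \<in> D \<Longrightarrow> \<bar>u x\<bar> < c \<and> 0 < n x"
    and bern: "\<And>x. x \<in> D \<Longrightarrow> bernoulli c \<gamma> R A (u x) (n x) (S x) = B"
    and euler: "euler_at c \<gamma> R A u n S D y"
  shows "(S has_real_derivative 0) (at y within D)"
proof -
  define v where "v = (\<lambda>x. u x / c)"
  define w where "w = (\<lambda>x. heat_ratio (n x) (S x))"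
  have u: "u = (\<lambda>x. c * v x)"
    using c_pos by (simp add: v_def)
  have v1: "\<bar>v x\<bar> < 1" if "x \<in> D" for x
    using state[OF that] c_pos by (simp add: v_def abs_divide)
  have w_eq: "B / c * lor (v x) - 1 = w x" if "x \<in> D" for x
    using bern[OF that] state[OF that] bernoulli_eq[of "n x" "v x" "S x"] c_pos lor_pos[OF v1[OF that]]
    by (simp add: u w_def field_simps)
  from euler obtain u' p' where
    u': "(u has_real_derivative u') (at y within D)" and
    p': "((\<lambda>x. p (n x) (S x)) has_real_derivative p') (at y within D)" and
    eq: "u y * u' + (c\<^sup>2 - (u y)\<^sup>2) / (p (n y) (S y) + energy_density c \<gamma> R A (n y) (S y) * c\<^sup>2) * p' = 0"
    unfolding euler_at_def by blast
  define w' where "w' = - (1 + w y) * v y * (u' / c) / (lor (v y))\<^sup>2"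
  note ny = conjunct2[OF state[OF D]]
  have w_y: "heat_ratio (n y) (S y) = w y"
    by (simp add: w_def)
  have wy: "0 < w y"
    using heat_ratio_pos[OF ny] by (simp add: w_def)
  have v': "(v has_real_derivative u' / c) (at y within D)"
    unfolding v_def using u' by (rule DERIV_cdivide)
  have "((\<lambda>x. B / c * lor (v x) - 1) has_real_derivative w') (at y within D)"
    unfolding w'_def using heat_ratio_deriv_of_level[OF v' v1[OF D] w_eq[OF D]] .
  then have dw: "(w has_real_derivative w') (at y within D)"
    by (rule has_field_derivative_transform_within[OF _ zero_less_one D]) (rule w_eq)
  have p'_eq: "p' = c\<^sup>2 * n y * w'"
  proof -
    have "c * v y * (c * (u' / c)) + c\<^sup>2 * (lor (v y))\<^sup>2 / (n y * c\<^sup>2 * (1 + w y)) * p' = 0"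
      using eq c_pos unfolding enthalpy_eq[OF ny] u speed_power2[OF c_pos v1[OF D]] w_y by simp
    then show ?thesis
      unfolding w'_def using ny wy lor_pos[OF v1[OF D]] by (subst (asm) momentum_balance_iff) auto
  qed
  have "((\<lambda>x. R * (\<gamma> / (\<gamma> - 1) * ln (w x) - ln (p (n x) (S x)) - (ln A + \<gamma> * offset) / (\<gamma> - 1)))
      has_real_derivative R * (\<gamma> / (\<gamma> - 1) * (1 / w y * w') - 1 / p (n y) (S y) * p' - 0)) (at y within D)"
    using wy pressure_pos[OF ny]
    by (intro DERIV_diff DERIV_cmult DERIV_const DERIV_chain2[OF DERIV_ln_divide dw]
        DERIV_chain2[OF DERIV_ln_divide p']) auto
  also have "\<gamma> / (\<gamma> - 1) * (1 / w y * w') - 1 / p (n y) (S y) * p' - 0 = 0"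
    unfolding p'_eq pressure_eq[OF ny] w_y
    using c_pos ny wy gamma_gt_1 by simp
  finally have "((\<lambda>x. R * (\<gamma> / (\<gamma> - 1) * ln (w x) - ln (p (n x) (S x)) - (ln A + \<gamma> * offset) / (\<gamma> - 1)))
      has_real_derivative 0) (at y within D)"
    by simp
  then show ?thesis
    by (rule has_field_derivative_transform_within[OF _ zero_less_one D])
      (use entropy_of_pressure state in \<open>simp add: w_def\<close>)
qed

lemma smooth_region_constants:
  assumes "convex I"
    and state: "\<And>x. x \<in> I \<Longrightarrow> \<bar>u x\<bar> < c \<and> 0 < n x"
    and euler: "\<And>y. y \<in> I \<Longrightarrow> euler_at c \<gamma> R A u n S I y"
  obtains J B \<sigma> where "\<And>y. y \<in> I \<Longrightarrow> y\<^sup>2 * mass_flux c (u y) (n y) = J"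
    "\<And>y. y \<in> I \<Longrightarrow> bernoulli c \<gamma> R A (u y) (n y) (S y) = B" "\<And>y. y \<in> I \<Longrightarrow> S y = \<sigma>"
proof -
  obtain J where J: "\<And>y. y \<in> I \<Longrightarrow> y\<^sup>2 * mass_flux c (u y) (n y) = J"
    using has_field_derivative_zero_constant[OF assms(1), of "\<lambda>x. x\<^sup>2 * mass_flux c (u x) (n x)"] euler
    by (auto simp: euler_at_def)
  obtain B where B: "\<And>y. y \<in> I \<Longrightarrow> bernoulli c \<gamma> R A (u y) (n y) (S y) = B"
    using has_field_derivative_zero_constant[OF assms(1), of "\<lambda>x. bernoulli c \<gamma> R A (u x) (n x) (S x)"] euler
    by (auto simp: euler_at_def)
  obtain \<sigma> where "\<And>y. y \<in> I \<Longrightarrow> S y = \<sigma>"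
    using has_field_derivative_zero_constant[OF assms(1), of S] entropy_stationary[OF _ state B euler]
    by auto
  with J B show thesis
    by (rule that)
qed

end

lemma euler_at_subset:
  "euler_at c \<gamma> R A u n S D y \<Longrightarrow> I \<subseteq> D \<Longrightarrow> euler_at c \<gamma> R A u n S I y"
  unfolding euler_at_def by (blast intro: has_field_derivative_subset)

locale gas_flow = polytropic_gas c \<gamma> R A + bernoulli_level \<gamma> H for c \<gamma> R A H :: real
begin

definition rest_density :: "real \<Rightarrow> real \<Rightarrow> real" where
  "rest_density j v = j * lor v / v"

text \<open>
  The entropy of the state with mass flux \<open>j\<close> and speed \<open>v\<close>; see \<open>state_iff\<close>.
\<close>

definition state_entropy :: "real \<Rightarrow> real \<Rightarrow> real" where
  "state_entropy j v = R * (log_flux v - ln j - (offset + ln A) / (\<gamma> - 1))"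

lemma rest_density_pos: "0 < j \<Longrightarrow> 0 < v \<Longrightarrow> v < vmax \<Longrightarrow> 0 < rest_density j v"
  using thermal_pos[of v] by (simp add: rest_density_def)

lemma heat_ratio_eq_thermal_iff:
  assumes "0 < j" "0 < v" "v < vmax"
  shows "heat_ratio (rest_density j v) S = thermal v \<longleftrightarrow> S = state_entropy j v"
proof -
  have "ln (rest_density j v) = ln j + ln (lor v) - ln v"
    using assms thermal_pos[of v] by (simp add: rest_density_def ln_mult ln_div)
  then show ?thesis
    using heat_ratio_eq_iff[OF rest_density_pos[OF assms], of "thermal v" S] assms thermal_pos[of v]
    by (simp only: state_entropy_def log_flux_def) (simp add: algebra_simps)
qed

text \<open>
  The mass flux fixes \<open>n\<close> in terms of \<open>v\<close>, the Bernoulli law fixes \<open>w\<close>, and \<open>n\<close> and \<open>w\<close>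
  together fix the entropy.  Positivity of \<open>w\<close> is what confines \<open>v\<close> below \<open>vmax\<close>.
\<close>

lemma state_iff:
  assumes "\<bar>v\<bar> < 1" "0 < n" "0 < j"
  shows "mass_flux c (c * v) n = j \<and> bernoulli c \<gamma> R A (c * v) n S = c * H \<longleftrightarrow>
    0 < v \<and> v < vmax \<and> n = rest_density j v \<and> S = state_entropy j v"
proof
  note s = lor_pos[OF assms(1)]
  assume *: "mass_flux c (c * v) n = j \<and> bernoulli c \<gamma> R A (c * v) n S = c * H"
  then have j: "n * v / lor v = j"
    by (simp add: mass_flux_eq)
  then have "0 < n * v"
    using s assms by (simp add: field_simps)
  then have v: "0 < v"
    using assms by (simp add: zero_less_mult_iff)
  have n: "n = rest_density j v"
    using j v s by (simp add: rest_density_def field_simps)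
  have w: "heat_ratio n S = thermal v"
  proof -
    have "c * ((1 + heat_ratio n S) / lor v) = c * H"
      using * bernoulli_eq[OF assms(2), of v S] by metis
    then have "(1 + heat_ratio n S) / lor v = H"
      using c_pos by (simp only: mult_cancel_left) auto
    then show ?thesis
      using s by (auto simp: thermal_def)
  qed
  then have v': "v < vmax"
    using thermal_pos_imp_less_vmax heat_ratio_pos[OF assms(2), of S] by simp
  show "0 < v \<and> v < vmax \<and> n = rest_density j v \<and> S = state_entropy j v"
    using heat_ratio_eq_thermal_iff[OF assms(3) v v', of S] v v' n w by simp
next
  note s = lor_pos[OF assms(1)]
  assume *: "0 < v \<and> v < vmax \<and> n = rest_density j v \<and> S = state_entropy j v"
  then have w: "heat_ratio n S = thermal v"
    using heat_ratio_eq_thermal_iff[OF assms(3)] by simp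
  have "bernoulli c \<gamma> R A (c * v) n S = c * H"
    unfolding bernoulli_eq[OF assms(2)] w using s by (simp add: thermal_def)
  then show "mass_flux c (c * v) n = j \<and> bernoulli c \<gamma> R A (c * v) n S = c * H"
    using * s by (simp add: mass_flux_eq rest_density_def)
qed

lemma state_fluxes:
  assumes "0 < j" "0 < v" "v < vmax"
  defines "n \<equiv> rest_density j v" and "S \<equiv> state_entropy j v"
  shows "mass_flux c (c * v) n = j" "bernoulli c \<gamma> R A (c * v) n S = c * H"
    "momentum_flux c \<gamma> R A (c * v) n S = c\<^sup>2 * (j * impulse v)"
    "p n S = \<kappa> * c\<^sup>2 * j * (lor v * thermal v / v)"
    "heat_ratio n S = thermal v"
proof -
  note pos = thermal_pos[OF less_imp_le[OF assms(2)] assms(3)]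
  have v: "\<bar>v\<bar> < 1" and n: "0 < n"
    using assms pos rest_density_pos by auto
  show "mass_flux c (c * v) n = j" "bernoulli c \<gamma> R A (c * v) n S = c * H"
    using state_iff[OF v n assms(1), of S] assms by auto
  show w: "heat_ratio n S = thermal v"
    using heat_ratio_eq_thermal_iff[OF assms(1-3)] by (simp add: n_def S_def)
  show "p n S = \<kappa> * c\<^sup>2 * j * (lor v * thermal v / v)"
    using pressure_eq[OF n, of S] unfolding w by (simp add: n_def rest_density_def \<kappa>_def)
  have h: "1 + thermal v = H * lor v"
    by (simp add: thermal_def)
  have "momentum_flux c \<gamma> R A (c * v) n S =
    c\<^sup>2 * (n * (H * lor v) * v\<^sup>2 / (lor v)\<^sup>2 + \<kappa> * n * thermal v)"
    using momentum_flux_eq[OF n v, of S] unfolding w h by (simp add: \<kappa>_def)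
  also have "n * (H * lor v) * v\<^sup>2 / (lor v)\<^sup>2 + \<kappa> * n * thermal v = j * impulse v"
    using pos assms(2) by (simp add: n_def rest_density_def impulse_def field_simps power2_eq_square)
  finally show "momentum_flux c \<gamma> R A (c * v) n S = c\<^sup>2 * (j * impulse v)" .
qed

text \<open>
  Converse of \<open>entropy_stationary\<close>: at constant entropy the pressure is a constant times
  \<open>w powr (\<gamma> / (\<gamma> - 1))\<close>, so its derivative is \<open>c\<^sup>2 n w'\<close>.  The fields \<open>u, n, S\<close> are compared with the
  smooth flow \<open>v\<close> only on \<open>D\<close>, so that the lemma applies on either side of a shock and at the end points.
\<close>

lemma euler_atI:
  assumes U: "open U" "y \<in> U" "y \<in> D" and J: "0 < J"
    and v': "(v has_real_derivative v') (at y)"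
    and v: "\<And>x. x \<in> U \<Longrightarrow> 0 < x \<and> 0 < v x \<and> v x < vmax \<and> state_entropy (J / x\<^sup>2) (v x) = \<sigma>"
    and state: "\<And>x. x \<in> U \<Longrightarrow> x \<in> D \<Longrightarrow> u x = c * v x \<and> n x = rest_density (J / x\<^sup>2) (v x) \<and> S x = \<sigma>"
  shows "euler_at c \<gamma> R A u n S D y"
proof -
  obtain d where d: "0 < d" "ball y d \<subseteq> U"
    using U open_contains_ball by blast
  have inU: "x \<in> U" if "dist x y < d" for x
    using that d by (auto simp: dist_commute)
  have transfer: "(f has_real_derivative f') (at y within D)"
    if "(g has_real_derivative f') (at y within D)" "\<And>x. x \<in> U \<Longrightarrow> x \<in> D \<Longrightarrow> g x = f x" for f g f'
    by (rule has_field_derivative_transform_within[OF that(1) d(1) U(3)]) (use that(2) inU in auto)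
  have flux: "0 < J / x\<^sup>2" if "x \<in> U" for x
    using v[OF that] J by simp
  have eqs: "mass_flux c (u x) (n x) = J / x\<^sup>2" "bernoulli c \<gamma> R A (u x) (n x) (S x) = c * H"
      "heat_ratio (n x) (S x) = thermal (v x)" "0 < n x" if "x \<in> U" "x \<in> D" for x
    using state_fluxes[OF flux, of x "v x"] v[of x] state[of x] rest_density_pos[OF flux, of x "v x"] that
    by auto
  note y = eqs[OF U(2,3)]
  have vy: "0 < v y" "v y < vmax" "\<bar>v y\<bar> < 1" "0 < thermal (v y)" "0 < lor (v y)"
    using v[OF U(2)] thermal_pos[of "v y"] by auto
  have mass: "((\<lambda>x. x\<^sup>2 * mass_flux c (u x) (n x)) has_real_derivative 0) (at y within D)"
    by (rule transfer[of "\<lambda>_. J"]) (use eqs v in \<open>fastforce simp: \<open>0 < J\<close>\<close>)+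
  have bern: "((\<lambda>x. bernoulli c \<gamma> R A (u x) (n x) (S x)) has_real_derivative 0) (at y within D)"
    by (rule transfer[of "\<lambda>_. c * H"]) (use eqs in auto)
  define w' where "w' = - (1 + thermal (v y)) * v y * v' / (lor (v y))\<^sup>2"
  have w': "((\<lambda>x. thermal (v x)) has_real_derivative w') (at y within D)"
    unfolding thermal_def[abs_def] w'_def
    by (rule heat_ratio_deriv_of_level) (use v' vy in \<open>auto intro: has_field_derivative_at_within\<close>)
  have u': "(u has_real_derivative c * v') (at y within D)"
    by (rule transfer[of "\<lambda>x. c * v x"])
      (use v' state in \<open>auto intro!: DERIV_cmult intro: has_field_derivative_at_within\<close>)
  let ?P = "\<lambda>x. exp (\<gamma> / (\<gamma> - 1) * ln (thermal (v x)) - \<sigma> / R - (ln A + \<gamma> * offset) / (\<gamma> - 1))"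
  have P: "p (n x) (S x) = ?P x" if "x \<in> U" "x \<in> D" for x
    using pressure_of_entropy[OF eqs(4)[OF that], of "S x"] eqs(3)[OF that] state[OF that] by simp
  have "(?P has_real_derivative ?P y * (\<gamma> / (\<gamma> - 1) * (w' / thermal (v y)))) (at y within D)"
  proof -
    have "((\<lambda>x. \<gamma> / (\<gamma> - 1) * ln (thermal (v x)) - \<sigma> / R - (ln A + \<gamma> * offset) / (\<gamma> - 1))
        has_real_derivative \<gamma> / (\<gamma> - 1) * (1 / thermal (v y) * w') - 0 - 0) (at y within D)"
      using vy
      by (intro DERIV_diff DERIV_cmult DERIV_const DERIV_chain2[OF DERIV_ln_divide w']) auto
    from DERIV_chain2[OF DERIV_exp this] show ?thesis
      by simp
  qed
  also have "?P y * (\<gamma> / (\<gamma> - 1) * (w' / thermal (v y))) = c\<^sup>2 * n y * w'"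
    unfolding P[OF U(2,3), symmetric] pressure_eq[OF y(4)] y(3)
    using vy gamma by simp
  finally have p': "((\<lambda>x. p (n x) (S x)) has_real_derivative c\<^sup>2 * n y * w') (at y within D)"
    by (rule transfer) (use P in auto)
  have "u y * (c * v') + (c\<^sup>2 - (u y)\<^sup>2) /
      (p (n y) (S y) + energy_density c \<gamma> R A (n y) (S y) * c\<^sup>2) * (c\<^sup>2 * n y * w') = 0"
    unfolding enthalpy_eq[OF y(4)] y(3) conjunct1[OF state[OF U(2,3)]] speed_power2[OF c_pos vy(3)]
    unfolding w'_def using y(4) vy by (subst momentum_balance_iff) auto
  then show ?thesis
    unfolding euler_at_def using mass bern u' p' by blast
qed

end

section \<open>Smooth flows in the radial geometry\<close>

context bernoulli_level
begin

text \<open>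
  The flows with \<open>log_flux v + 2 ln y = C\<close> exist for those radii \<open>y\<close> at which \<open>C - 2 ln y\<close> is below the
  maximum of \<open>log_flux\<close>, that is, outside the radius where the flow would be sonic.
\<close>

definition choking_radius :: "real \<Rightarrow> real" where
  "choking_radius C = exp ((C - log_flux sonic) / 2)"

lemma choking_radius_less_iff:
  assumes "0 < y"
  shows "choking_radius C < y \<longleftrightarrow> C - 2 * ln y < log_flux sonic"
proof -
  have "choking_radius C < y \<longleftrightarrow> (C - log_flux sonic) / 2 < ln y"
    using assms by (metis choking_radius_def exp_less_cancel_iff exp_ln)
  then show ?thesis
    by (simp add: field_simps)
qed

lemma choking_radius_pos: "0 < choking_radius C"
  by (simp add: choking_radius_def)

text \<open>
  What the subsonic and the supersonic inverse of \<open>log_flux\<close> have in common; the properties of smooth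
  flows are derived from it once for both.
\<close>

definition regular_branch :: "(real \<Rightarrow> real) \<Rightarrow> bool" where
  "regular_branch b \<longleftrightarrow> (\<forall>t < log_flux sonic. 0 < b t \<and> b t < vmax \<and> log_flux (b t) = t \<and>
     mach_excess (b t) \<noteq> 0 \<and>
     (b has_real_derivative inverse (- mach_excess (b t) / (\<kappa> * (b t * thermal (b t) * lor (b t))))) (at t))"

lemma regular_sub_branch: "regular_branch sub_branch"
  unfolding regular_branch_def
proof (intro allI impI conjI)
  fix t assume t: "t < log_flux sonic"
  note b = sub_branch[OF t]
  show "mach_excess (sub_branch t) \<noteq> 0"
    using b mach_excess_neg[of "sub_branch t"] by simp
qed (use sub_branch sub_branch_deriv in auto)

lemma regular_sup_branch: "regular_branch sup_branch"
  unfolding regular_branch_def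
proof (intro allI impI conjI)
  fix t assume t: "t < log_flux sonic"
  note b = sup_branch[OF t]
  show "mach_excess (sup_branch t) \<noteq> 0"
    using b mach_excess_pos[of "sup_branch t"] vmax by simp
qed (use sup_branch sup_branch_deriv in auto)

lemma branch_flow:
  assumes "regular_branch b" "choking_radius C < y"
  defines "v \<equiv> b (C - 2 * ln y)"
  shows "0 < v" "v < vmax" "log_flux v = C - 2 * ln y" "mach_excess v \<noteq> 0"
    "((\<lambda>y. b (C - 2 * ln y)) has_real_derivative
      2 * \<kappa> * (v * thermal v * lor v) * inverse (mach_excess v) * inverse y) (at y)"
proof -
  have y: "0 < y"
    using assms(2) choking_radius_pos[of C] by simp
  have t: "C - 2 * ln y < log_flux sonic"
    using assms(2) choking_radius_less_iff[OF y] by simp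
  note b = assms(1)[unfolded regular_branch_def, rule_format, OF t, folded v_def]
  show "0 < v" "v < vmax" "log_flux v = C - 2 * ln y" "mach_excess v \<noteq> 0"
    using b by auto
  have "((\<lambda>y. C - 2 * ln y) has_real_derivative 0 - 2 * (1 / y)) (at y)"
    using y by (intro DERIV_diff DERIV_const DERIV_cmult DERIV_ln_divide)
  moreover have "(b has_real_derivative
      inverse (- mach_excess v / (\<kappa> * (v * thermal v * lor v)))) (at (C - 2 * ln y))"
    using b by simp
  ultimately have "((\<lambda>y. b (C - 2 * ln y)) has_real_derivative
      inverse (- mach_excess v / (\<kappa> * (v * thermal v * lor v))) * (0 - 2 * (1 / y))) (at y)"
    by (rule DERIV_chain2[rotated])
  then show "((\<lambda>y. b (C - 2 * ln y)) has_real_derivative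
      2 * \<kappa> * (v * thermal v * lor v) * inverse (mach_excess v) * inverse y) (at y)"
    using b y by (simp add: field_simps)
qed

lemma times_differentiable_lor:
  assumes U: "open U" and v: "times_differentiable k U v" "\<And>y. y \<in> U \<Longrightarrow> \<bar>v y\<bar> < 1"
  shows "times_differentiable k U (\<lambda>y. lor (v y))"
proof -
  have pos: "0 < 1 + (-1) * (v y * v y)" if "y \<in> U" for y
    using v(2)[OF that] by (simp add: abs_square_less_1 flip: power2_eq_square)
  have "times_differentiable k U (\<lambda>y. (1 + (-1) * (v y * v y)) powr (1 / 2))"
    by (intro times_differentiable_powr times_differentiable_add times_differentiable_mult
        times_differentiable_const U v pos)
  then show ?thesis
    by (rule times_differentiable_cong[OF U, rotated])
      (use pos in \<open>force simp: lor_def powr_half_sqrt power2_eq_square\<close>)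
qed

text \<open>
  By \<open>branch_flow\<close> the derivative of the flow is an algebraic expression in the flow itself and \<open>y\<close>,
  without zeros in its denominators.  So if the flow is \<open>k\<close> times differentiable, so is its derivative.
\<close>

lemma branch_flow_smooth:
  assumes b: "regular_branch b"
  shows "smooth_on {choking_radius C<..} (\<lambda>y. b (C - 2 * ln y))"
  unfolding smooth_on_def
proof
  let ?U = "{choking_radius C<..}" and ?v = "\<lambda>y. b (C - 2 * ln y)"
  have U: "open ?U" by simp
  have v1: "\<bar>?v y\<bar> < 1" "lor (?v y) \<noteq> 0" if "y \<in> ?U" for y
    using branch_flow(1,2)[OF b, of C y] that thermal_pos[of "?v y"] by auto
  show "times_differentiable k ?U ?v" for k
  proof (induction k)
    case (Suc k)
    note lor = times_differentiable_lor[OF U Suc v1(1)]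
    have thermal: "times_differentiable k ?U (\<lambda>y. thermal (?v y))"
    proof -
      have "times_differentiable k ?U (\<lambda>y. H * lor (?v y) + (-1))"
        by (intro times_differentiable_add times_differentiable_mult times_differentiable_const U lor)
      then show ?thesis by (simp add: thermal_def)
    qed
    have mach: "times_differentiable k ?U (\<lambda>y. mach_excess (?v y))"
    proof -
      have "times_differentiable k ?U
          (\<lambda>y. H * (1 - \<kappa>) * (?v y * ?v y) + (- \<kappa> * H) + \<kappa> * inverse (lor (?v y)))"
        by (intro times_differentiable_add times_differentiable_mult times_differentiable_const
            times_differentiable_inverse U lor Suc v1(2))
      then show ?thesis
        by (simp add: mach_excess_def power2_eq_square divide_inverse)
    qed
    show ?case
    proof (rule times_differentiable_SucI[OF U branch_flow(5)[OF b]])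
      show "times_differentiable k ?U (\<lambda>y. 2 * \<kappa> * (?v y * thermal (?v y) * lor (?v y)) *
          inverse (mach_excess (?v y)) * inverse y)"
        using branch_flow(4)[OF b, of C] choking_radius_pos[of C]
        by (intro times_differentiable_mult times_differentiable_const times_differentiable_inverse
            times_differentiable_id U lor thermal mach Suc) auto
    qed simp
  qed simp
qed

end

context gas_flow
begin

lemma rest_density_smooth:
  assumes b: "regular_branch b"
  shows "smooth_on {choking_radius C<..} (\<lambda>y. rest_density (J / y\<^sup>2) (b (C - 2 * ln y)))"
  unfolding smooth_on_def
proof
  fix k
  let ?U = "{choking_radius C<..}" and ?v = "\<lambda>y. b (C - 2 * ln y)"
  have U: "open ?U" by simp
  have v: "times_differentiable k ?U ?v"
    using branch_flow_smooth[OF b] by (simp add: smooth_on_def)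
  have v1: "\<bar>?v y\<bar> < 1" "?v y \<noteq> 0" "y \<noteq> 0" if "y \<in> ?U" for y
    using branch_flow(1,2)[OF b, of C y] that thermal_pos[of "?v y"] choking_radius_pos[of C] by auto
  have "times_differentiable k ?U (\<lambda>y. J * inverse (y * y) * lor (?v y) * inverse (?v y))"
    using v1
    by (intro times_differentiable_mult times_differentiable_const times_differentiable_inverse
        times_differentiable_id times_differentiable_lor U v) auto
  then show "times_differentiable k ?U (\<lambda>y. rest_density (J / y\<^sup>2) (?v y))"
    by (simp add: rest_density_def divide_inverse power2_eq_square)
qed

text \<open>
  The entropy, expressed by the constant \<open>C\<close> in \<open>log_flux v + 2 ln y = C\<close> and the total flux \<open>J = j y\<^sup>2\<close>.
\<close>

definition entropy_level :: "real \<Rightarrow> real \<Rightarrow> real" where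
  "entropy_level J C = R * (C - ln J - (offset + ln A) / (\<gamma> - 1))"

lemma state_entropy_eq:
  assumes "0 < J" "0 < y"
  shows "state_entropy (J / y\<^sup>2) v = entropy_level J (log_flux v + 2 * ln y)"
  using assms by (simp add: state_entropy_def entropy_level_def ln_div ln_realpow)

lemma entropy_level_less_iff: "entropy_level J C < entropy_level J C' \<longleftrightarrow> C < C'"
  using R_pos by (simp add: entropy_level_def)

lemma entropy_level_eq_iff: "entropy_level J C = entropy_level J C' \<longleftrightarrow> C = C'"
  using R_pos by (simp add: entropy_level_def)

end

text \<open>
  The inlet data enter through the supersonic speed \<open>v0\<close> and the total flux \<open>J\<close>, the mass flux times
  \<open>y\<^sup>2\<close>; with \<open>H\<close> they determine the density and the entropy at the inlet by \<open>state_iff\<close>.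
\<close>

locale shock_problem = gas_flow c \<gamma> R A H for c \<gamma> R A H :: real +
  fixes r1 r2 J v0 :: real
  assumes r1: "0 < r1" and r12: "r1 < r2" and J: "0 < J" and v0: "sonic < v0" "v0 < vmax"
begin

text \<open>
  The constants of \<open>log_flux v + 2 ln y\<close> ahead of the shock (\<open>up_level\<close>) and behind it
  (\<open>down_level\<close>, which differs by the gain of entropy at the shock).
\<close>

definition up_level :: real where
  "up_level = log_flux v0 + 2 * ln r1"

definition upstream :: "real \<Rightarrow> real" where
  "upstream y = sup_branch (up_level - 2 * ln y)"

definition down_level :: "real \<Rightarrow> real" where
  "down_level rs = up_level + entropy_gain (upstream rs)"

definition downstream :: "real \<Rightarrow> real \<Rightarrow> real" where
  "downstream rs y = sub_branch (down_level rs - 2 * ln y)"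

lemma upstream_regular:
  assumes "r1 \<le> y"
  shows "up_level - 2 * ln y < log_flux sonic" "choking_radius up_level < y"
proof -
  have "ln r1 \<le> ln y" using assms r1 by simp
  then have "up_level - 2 * ln y \<le> log_flux v0"
    by (simp add: up_level_def)
  also have "\<dots> < log_flux sonic"
    using log_flux_less_sup[of sonic v0] v0 by simp
  finally show "up_level - 2 * ln y < log_flux sonic" .
  then show "choking_radius up_level < y"
    using assms r1 by (simp add: choking_radius_less_iff)
qed

lemma upstream:
  assumes "r1 \<le> y"
  shows "sonic < upstream y" "upstream y < vmax" "0 < upstream y" "log_flux (upstream y) = up_level - 2 * ln y"
  using sup_branch[OF upstream_regular(1)[OF assms]] by (auto simp: upstream_def)

lemma upstream_inlet: "upstream r1 = v0"
  using v0 by (simp add: upstream_def up_level_def sup_branch_log_flux)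

lemma down_level_eq: "r1 \<le> rs \<Longrightarrow> down_level rs = log_flux (post_shock (upstream rs)) + 2 * ln rs"
  using upstream(4)[of rs] by (simp add: down_level_def entropy_gain_def)

lemma down_level_gt: "r1 \<le> rs \<Longrightarrow> up_level < down_level rs"
  using entropy_gain_pos[OF upstream(1,2), of rs] by (simp add: down_level_def)

text \<open>
  Already at the shock \<open>log_flux\<close> is below its maximum, because the post-shock speed is subsonic, and
  \<open>- 2 ln y\<close> only lowers it further out: the downstream flow extends to every larger radius.
\<close>

lemma downstream_regular:
  assumes "r1 \<le> rs" "rs \<le> y"
  shows "down_level rs - 2 * ln y < log_flux sonic" "choking_radius (down_level rs) < y"
proof -
  have "ln rs \<le> ln y" using assms r1 by simp
  then have "down_level rs - 2 * ln y \<le> log_flux (post_shock (upstream rs))"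
    using assms by (simp add: down_level_eq)
  also have "\<dots> < log_flux sonic"
    using post_shock[OF upstream(1,2)[OF assms(1)]] log_flux_less_sub by simp
  finally show "down_level rs - 2 * ln y < log_flux sonic" .
  then show "choking_radius (down_level rs) < y"
    using assms r1 by (simp add: choking_radius_less_iff)
qed

lemma downstream:
  assumes "r1 \<le> rs" "rs \<le> y"
  shows "0 < downstream rs y" "downstream rs y < sonic" "downstream rs y < vmax"
    "log_flux (downstream rs y) = down_level rs - 2 * ln y"
  using sub_branch[OF downstream_regular(1)[OF assms]] by (auto simp: downstream_def)

lemma downstream_shock: "r1 \<le> rs \<Longrightarrow> downstream rs rs = post_shock (upstream rs)"
  using post_shock[OF upstream(1,2), of rs] by (simp add: downstream_def down_level_eq sub_branch_log_flux)

lemma upstream_less: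
  assumes "r1 \<le> x" "x < y"
  shows "upstream x < upstream y"
proof -
  have "ln x < ln y" using assms r1 by simp
  then have "log_flux (upstream y) < log_flux (upstream x)"
    using assms upstream(4) by simp
  then have "\<not> upstream y \<le> upstream x"
    using log_flux_less_sup[of "upstream y" "upstream x"] upstream[of x] upstream[of y] assms
    by force
  then show ?thesis by simp
qed

lemma upstream_deriv:
  assumes "choking_radius up_level < y"
  shows "\<exists>v'. (upstream has_real_derivative v') (at y)"
  unfolding upstream_def[abs_def] by (rule exI, rule branch_flow(5)[OF regular_sup_branch assms])

lemma downstream_deriv:
  assumes "choking_radius (down_level rs) < y"
  shows "\<exists>v'. (downstream rs has_real_derivative v') (at y)"
  unfolding downstream_def[abs_def] by (rule exI, rule branch_flow(5)[OF regular_sub_branch assms])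

definition speed :: "real \<Rightarrow> real \<Rightarrow> real" where
  "speed rs y = (if y < rs then upstream y else downstream rs y)"

definition shock_u :: "real \<Rightarrow> real \<Rightarrow> real" where
  "shock_u rs y = c * speed rs y"

definition shock_n :: "real \<Rightarrow> real \<Rightarrow> real" where
  "shock_n rs y = rest_density (J / y\<^sup>2) (speed rs y)"

definition shock_S :: "real \<Rightarrow> real \<Rightarrow> real" where
  "shock_S rs y = entropy_level J (if y < rs then up_level else down_level rs)"

definition exit_pressure :: "real \<Rightarrow> real" where
  "exit_pressure rs = (let v = downstream rs r2 in \<kappa> * c\<^sup>2 * (J / r2\<^sup>2) * (lor v * thermal v / v))"

lemma flux_pos: "r1 \<le> y \<Longrightarrow> 0 < J / y\<^sup>2"
  using J r1 by simp

section \<open>The flow with a shock at a given position\<close>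

lemma speed_state:
  assumes "r1 < rs" "r1 \<le> y"
  shows "0 < speed rs y" "speed rs y < vmax" "shock_S rs y = state_entropy (J / y\<^sup>2) (speed rs y)"
proof -
  show "0 < speed rs y" "speed rs y < vmax"
    using assms upstream[of y] downstream[of rs y] by (auto simp: speed_def)
  have "log_flux (speed rs y) = (if y < rs then up_level else down_level rs) - 2 * ln y"
    using assms upstream(4)[of y] downstream(4)[of rs y] by (simp add: speed_def)
  then show "shock_S rs y = state_entropy (J / y\<^sup>2) (speed rs y)"
    using assms r1 by (simp add: shock_S_def state_entropy_eq[OF J])
qed

lemma shock_fluxes:
  assumes "r1 < rs" "r1 \<le> y"
  shows "mass_flux c (shock_u rs y) (shock_n rs y) = J / y\<^sup>2"
    "bernoulli c \<gamma> R A (shock_u rs y) (shock_n rs y) (shock_S rs y) = c * H"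
    "momentum_flux c \<gamma> R A (shock_u rs y) (shock_n rs y) (shock_S rs y) = c\<^sup>2 * (J / y\<^sup>2 * impulse (speed rs y))"
    "p (shock_n rs y) (shock_S rs y) = \<kappa> * c\<^sup>2 * (J / y\<^sup>2) * (lor (speed rs y) * thermal (speed rs y) / speed rs y)"
  using state_fluxes[OF flux_pos[OF assms(2)] speed_state(1,2)[OF assms]]
  by (simp_all add: shock_u_def shock_n_def speed_state(3)[OF assms])

lemma shock_flow_smooth:
  assumes rs: "r1 < rs" "rs < r2"
  shows "piecewise_smooth r1 r2 rs (shock_u rs)" "piecewise_smooth r1 r2 rs (shock_n rs)"
    "piecewise_smooth r1 r2 rs (shock_S rs)"
proof -
  let ?U = "{choking_radius up_level<..}" and ?V = "{choking_radius (down_level rs)<..}"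
  have sub: "{r1..rs} \<subseteq> ?U" "{rs..r2} \<subseteq> ?V"
    using upstream_regular(2) downstream_regular(2)[of rs] rs by auto
  have const: "smooth_on U (\<lambda>_. a)" if "open U" for U a
    using that by (simp add: smooth_on_def times_differentiable_const)
  have cmult: "smooth_on U (\<lambda>y. c * f y)" if "open U" "smooth_on U f" for U f
    using that by (simp add: smooth_on_def times_differentiable_const times_differentiable_mult)
  have "piecewise_smooth r1 r2 rs (\<lambda>y. if y < rs then c * upstream y else c * downstream rs y)"
    unfolding upstream_def downstream_def
    by (rule piecewise_smooth_glue[OF _ _ sub rs])
      (intro cmult branch_flow_smooth regular_sub_branch regular_sup_branch open_greaterThan)+
  also have "(\<lambda>y. if y < rs then c * upstream y else c * downstream rs y) = shock_u rs"
    by (auto simp: shock_u_def speed_def)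
  finally show "piecewise_smooth r1 r2 rs (shock_u rs)" .
  have "piecewise_smooth r1 r2 rs (\<lambda>y. if y < rs then rest_density (J / y\<^sup>2) (upstream y)
      else rest_density (J / y\<^sup>2) (downstream rs y))"
    unfolding upstream_def downstream_def
    by (rule piecewise_smooth_glue[OF _ _ sub rs])
      (intro rest_density_smooth regular_sub_branch regular_sup_branch)+
  also have "(\<lambda>y. if y < rs then rest_density (J / y\<^sup>2) (upstream y)
      else rest_density (J / y\<^sup>2) (downstream rs y)) = shock_n rs"
    by (auto simp: shock_n_def speed_def)
  finally show "piecewise_smooth r1 r2 rs (shock_n rs)" .
  have "piecewise_smooth r1 r2 rs (\<lambda>y. if y < rs then entropy_level J up_level else entropy_level J (down_level rs))"
    by (rule piecewise_smooth_glue[OF _ _ sub rs]) (intro const open_greaterThan)+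
  also have "(\<lambda>y. if y < rs then entropy_level J up_level else entropy_level J (down_level rs)) = shock_S rs"
    by (auto simp: shock_S_def)
  finally show "piecewise_smooth r1 r2 rs (shock_S rs)" .
qed

lemma shock_flow_euler:
  assumes rs: "r1 < rs" and y: "y \<in> {r1..r2} - {rs}"
  shows "euler_at c \<gamma> R A (shock_u rs) (shock_n rs) (shock_S rs) ({r1..r2} - {rs}) y"
proof (cases "y < rs")
  case True
  have cy: "choking_radius up_level < y"
    using y upstream_regular by simp
  then obtain v' where v': "(upstream has_real_derivative v') (at y)"
    using upstream_deriv by blast
  show ?thesis
  proof (rule euler_atI[OF _ _ y J v', of "{choking_radius up_level<..<rs}" "entropy_level J up_level"])
    fix x assume x: "x \<in> {choking_radius up_level<..<rs}"
    then show "0 < x \<and> 0 < upstream x \<and> upstream x < vmax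
        \<and> state_entropy (J / x\<^sup>2) (upstream x) = entropy_level J up_level"
      using choking_radius_pos[of up_level] branch_flow[OF regular_sup_branch, of up_level x]
      by (auto simp: upstream_def state_entropy_eq[OF J])
    show "shock_u rs x = c * upstream x \<and> shock_n rs x = rest_density (J / x\<^sup>2) (upstream x) \<and>
        shock_S rs x = entropy_level J up_level"
      using x by (simp add: shock_u_def shock_n_def shock_S_def speed_def)
  qed (use True cy in auto)
next
  case False
  then have rsy: "rs < y"
    using y by simp
  have cy: "choking_radius (down_level rs) < y"
    using downstream_regular[of rs y] rs rsy by simp
  then obtain v' where v': "(downstream rs has_real_derivative v') (at y)"
    using downstream_deriv by blast
  have c1: "choking_radius (down_level rs) < rs"
    using downstream_regular[of rs rs] rs by simp
  show ?thesis
  proof (rule euler_atI[OF _ _ y J v', of "{rs<..}" "entropy_level J (down_level rs)"])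
    fix x assume x: "x \<in> {rs<..}"
    then show "0 < x \<and> 0 < downstream rs x \<and> downstream rs x < vmax
        \<and> state_entropy (J / x\<^sup>2) (downstream rs x) = entropy_level J (down_level rs)"
      using rs r1 downstream[of rs x] by (auto simp: state_entropy_eq[OF J])
    show "shock_u rs x = c * downstream rs x \<and> shock_n rs x = rest_density (J / x\<^sup>2) (downstream rs x) \<and>
        shock_S rs x = entropy_level J (down_level rs)"
      using x by (simp add: shock_u_def shock_n_def shock_S_def speed_def)
  qed (use rsy in auto)
qed

lemma shock_solution_exists:
  assumes rs: "r1 < rs" "rs < r2"
  shows "shock_solution c \<gamma> R A r1 r2 (c * v0) (rest_density (J / r1\<^sup>2) v0) (state_entropy (J / r1\<^sup>2) v0)
    (exit_pressure rs) rs (shock_u rs) (shock_n rs) (shock_S rs)"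
  unfolding shock_solution_def
proof (intro conjI ballI shock_flow_smooth shock_flow_euler rs)
  note rs0 = less_trans[OF r1 rs(1)]
  have sq: "isCont (\<lambda>y. J / y\<^sup>2) rs"
    using rs0 by (intro continuous_intros) auto
  show "\<bar>shock_u rs y\<bar> < c" "0 < shock_n rs y" if "y \<in> {r1..r2} - {rs}" for y
  proof -
    note v = speed_state(1,2)[OF rs(1), of y] flux_pos[of y]
    have "\<bar>speed rs y\<bar> < 1"
      using v that thermal_pos[of "speed rs y"] by auto
    then show "\<bar>shock_u rs y\<bar> < c"
      using c_pos by (simp add: shock_u_def abs_mult)
    show "0 < shock_n rs y"
      using v that by (auto simp: shock_n_def rest_density_pos)
  qed
  show "shock_u rs r1 = c * v0" "shock_n rs r1 = rest_density (J / r1\<^sup>2) v0"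
    using rs by (simp_all add: shock_u_def shock_n_def speed_def upstream_inlet)
  show "shock_S rs r1 = state_entropy (J / r1\<^sup>2) v0"
    using rs r1 by (simp add: shock_S_def state_entropy_eq[OF J] up_level_def)
  show "p (shock_n rs r2) (shock_S rs r2) = exit_pressure rs"
    using shock_fluxes(4)[OF rs(1), of r2] rs by (simp add: exit_pressure_def speed_def Let_def)
  have "has_jump (\<lambda>y. mass_flux c (shock_u rs y) (shock_n rs y)) j rs
      \<longleftrightarrow> j = J / rs\<^sup>2 - J / rs\<^sup>2" for j
    by (rule has_jump_pieces[OF rs _ _ sq sq]) (use rs shock_fluxes(1) in auto)
  then show "has_jump (\<lambda>y. mass_flux c (shock_u rs y) (shock_n rs y)) 0 rs"
    by simp
  have "has_jump (\<lambda>y. bernoulli c \<gamma> R A (shock_u rs y) (shock_n rs y) (shock_S rs y)) j rs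
      \<longleftrightarrow> j = (\<lambda>_. c * H) rs - (\<lambda>_. c * H) rs" for j
    by (rule has_jump_pieces[OF rs]) (use rs shock_fluxes(2) in auto)
  then show "has_jump (\<lambda>y. bernoulli c \<gamma> R A (shock_u rs y) (shock_n rs y) (shock_S rs y)) 0 rs"
    by simp
  have "has_jump (shock_S rs) j rs
      \<longleftrightarrow> j = (\<lambda>_. entropy_level J (down_level rs)) rs - (\<lambda>_. entropy_level J up_level) rs" for j
    by (rule has_jump_pieces[OF rs]) (auto simp: shock_S_def)
  then show "\<exists>j>0. has_jump (shock_S rs) j rs"
    using down_level_gt[of rs] rs by (auto simp: entropy_level_less_iff)
  let ?m = "\<lambda>v y. c\<^sup>2 * (J / y\<^sup>2 * impulse (v y))"
  have up: "isCont (?m upstream) rs"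
    using upstream_deriv[of rs] upstream_regular[of rs] upstream[of rs] rs sq
    by (intro continuous_mult continuous_const isCont_o2[OF _ impulse_cont]) (auto dest: DERIV_isCont)
  have down: "isCont (?m (downstream rs)) rs"
    using downstream_deriv[of rs rs] downstream_regular[of rs rs] downstream[of rs rs] rs sq
    by (intro continuous_mult continuous_const isCont_o2[OF _ impulse_cont]) (auto dest: DERIV_isCont)
  have "has_jump (\<lambda>y. momentum_flux c \<gamma> R A (shock_u rs y) (shock_n rs y) (shock_S rs y)) j rs
      \<longleftrightarrow> j = ?m (downstream rs) rs - ?m upstream rs" for j
    by (rule has_jump_pieces[OF rs _ _ up down])
      (use rs shock_fluxes(3) in \<open>auto simp: speed_def\<close>)
  then show "has_jump (\<lambda>y. momentum_flux c \<gamma> R A (shock_u rs y) (shock_n rs y) (shock_S rs y)) 0 rs"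
    using rs post_shock(4)[OF upstream(1,2), of rs] by (simp add: downstream_shock)
qed

end

section \<open>Every shock solution is the constructed one\<close>

context shock_problem
begin

text \<open>
  The pointwise content of the three conservation laws of a smooth region.
\<close>

lemma region_state:
  assumes y: "r1 \<le> y" and u: "\<bar>u\<bar> < c" and n: "0 < n"
    and flux: "y\<^sup>2 * mass_flux c u n = J" "bernoulli c \<gamma> R A u n S = c * H" "S = entropy_level J C"
  defines "v \<equiv> u / c"
  shows "0 < v" "v < vmax" "u = c * v" "n = rest_density (J / y\<^sup>2) v" "S = state_entropy (J / y\<^sup>2) v"
    "log_flux v = C - 2 * ln y"
proof -
  show uv: "u = c * v"
    using c_pos by (simp add: v_def)
  have v1: "\<bar>v\<bar> < 1"
    using u c_pos by (simp add: v_def abs_divide)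
  have "mass_flux c u n = J / y\<^sup>2"
    using flux(1) y r1 by (simp add: field_simps)
  then have *: "0 < v \<and> v < vmax \<and> n = rest_density (J / y\<^sup>2) v \<and> S = state_entropy (J / y\<^sup>2) v"
    using state_iff[OF v1 n flux_pos[OF y], of S] flux(2) uv by simp
  then show "0 < v" "v < vmax" "n = rest_density (J / y\<^sup>2) v" "S = state_entropy (J / y\<^sup>2) v"
    by auto
  have "entropy_level J C = entropy_level J (log_flux v + 2 * ln y)"
    using * flux(3) state_entropy_eq[OF J, of y v] y r1 by simp
  then show "log_flux v = C - 2 * ln y"
    by (simp add: entropy_level_eq_iff)
qed

text \<open>
  A shock solution only promises a limit of the speed at the shock, which a priori might be zero or
  \<open>vmax\<close>.  Since \<open>log_flux v\<close> is at least its value at the exit, the downstream speed lies between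
  the two speeds with that value, and so does its limit.
\<close>

lemma downstream_limit_regular:
  assumes rs: "r1 < rs" "rs < r2"
    and v: "\<And>y. rs < y \<Longrightarrow> y \<le> r2 \<Longrightarrow> 0 < v y \<and> v y < vmax \<and> log_flux (v y) = C - 2 * ln y"
    and lim: "(v \<longlongrightarrow> l) (at_right rs)"
  shows "0 < l" "l < vmax" "log_flux l = C - 2 * ln rs"
proof -
  let ?t = "C - 2 * ln r2"
  have ge: "?t \<le> log_flux (v y)" if "rs < y" "y \<le> r2" for y
    using v[OF that] that rs r1 by simp
  obtain y where y: "rs < y" "y < r2"
    using rs dense by blast
  have "ln y < ln r2"
    using y rs r1 by simp
  then have "?t < log_flux (v y)"
    using v[of y] y by simp
  also have "\<dots> \<le> log_flux sonic"
    using v[of y] y by (intro log_flux_le_sonic) auto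
  finally have t: "?t < log_flux sonic" .
  note sub = sub_branch[OF t] and sup = sup_branch[OF t]
  have bounds: "sub_branch ?t \<le> v y \<and> v y \<le> sup_branch ?t" if "rs < y" "y \<le> r2" for y
    using log_flux_less_sub[of "v y" "sub_branch ?t"] log_flux_less_sup[of "sup_branch ?t" "v y"]
      sub sup ge[OF that] v[OF that] by fastforce
  have ev: "\<forall>\<^sub>F y in at_right rs. rs < y \<and> y \<le> r2"
    using eventually_at_right_real[OF rs(2)] by (rule eventually_mono) auto
  have "sub_branch ?t \<le> l"
    by (rule tendsto_lowerbound[OF lim eventually_mono[OF ev]]) (use bounds in auto)
  moreover have "l \<le> sup_branch ?t"
    by (rule tendsto_upperbound[OF lim eventually_mono[OF ev]]) (use bounds in auto)
  ultimately show l: "0 < l" "l < vmax"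
    using sub sup by auto
  have "((\<lambda>y. log_flux (v y)) \<longlongrightarrow> log_flux l) (at_right rs)"
    by (rule isCont_tendsto_compose[OF log_flux_cont[OF l] lim])
  then have "((\<lambda>y. C - 2 * ln y) \<longlongrightarrow> log_flux l) (at_right rs)"
    by (rule Lim_transform_eventually) (use v in \<open>auto intro: eventually_mono[OF ev]\<close>)
  moreover have "((\<lambda>y. C - 2 * ln y) \<longlongrightarrow> C - 2 * ln rs) (at_right rs)"
    using rs r1 by (intro tendsto_intros) auto
  ultimately show "log_flux l = C - 2 * ln rs"
    by (intro tendsto_unique[of "at_right rs"]) auto
qed

text \<open>
  Ahead of the shock the inlet data fix all constants and the supersonic branch.  The jump conditions
  transport mass flux and Bernoulli constant to the other side.  There the limit \<open>l\<close> of the speed has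
  the impulse of the upstream state but, by the entropy condition, another \<open>log_flux\<close>; so it is the
  post-shock speed, and the flow behind the shock is subsonic.
\<close>

lemma shock_solution_eq:
  assumes sol: "shock_solution c \<gamma> R A r1 r2
      (c * v0) (rest_density (J / r1\<^sup>2) v0) (state_entropy (J / r1\<^sup>2) v0) pe rs u n S"
  shows "r1 < rs" "rs < r2" "pe = exit_pressure rs"
    "\<And>y. y \<in> {r1..r2} - {rs} \<Longrightarrow> u y = shock_u rs y \<and> n y = shock_n rs y \<and> S y = shock_S rs y"
proof -
  let ?D = "{r1..r2} - {rs}"
  let ?I = "{r1..<rs}" and ?K = "{rs<..r2}"
  let ?v = "\<lambda>y. u y / c"
  show rs: "r1 < rs" "rs < r2"
    using sol by (auto simp: shock_solution_def)
  have state: "\<bar>u y\<bar> < c \<and> 0 < n y" and euler: "euler_at c \<gamma> R A u n S ?D y" if "y \<in> ?D" for y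
    using sol that unfolding shock_solution_def by blast+
  have ps: "piecewise_smooth r1 r2 rs u"
    using sol by (simp add: shock_solution_def)
  have inlet: "u r1 = c * v0" "n r1 = rest_density (J / r1\<^sup>2) v0" "S r1 = state_entropy (J / r1\<^sup>2) v0"
    using sol by (auto simp: shock_solution_def)
  have sub: "?I \<subseteq> ?D" "?K \<subseteq> ?D"
    using rs by auto
  have eulerI: "euler_at c \<gamma> R A u n S ?I y" if "y \<in> ?I" for y
    by (rule euler_at_subset[OF euler sub(1)]) (use that sub in blast)
  have eulerK: "euler_at c \<gamma> R A u n S ?K y" if "y \<in> ?K" for y
    by (rule euler_at_subset[OF euler sub(2)]) (use that sub in blast)
  have v_cont: "continuous_on ?I ?v" "continuous_on ?K ?v"
    using piecewise_smooth_continuous_on(1)[OF ps, THEN continuous_on_subset] sub c_pos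
    by (auto intro!: continuous_intros)
  have sq: "isCont (\<lambda>y. a / y\<^sup>2) rs" for a
    using rs r1 by (intro continuous_intros) auto

  have left: "u y = c * upstream y" "n y = rest_density (J / y\<^sup>2) (upstream y)"
      "y\<^sup>2 * mass_flux c (u y) (n y) = J" "bernoulli c \<gamma> R A (u y) (n y) (S y) = c * H"
      "S y = entropy_level J up_level" if y: "y \<in> ?I" for y
  proof -
    obtain J1 B \<sigma> where
      *: "\<And>y. y \<in> ?I \<Longrightarrow> y\<^sup>2 * mass_flux c (u y) (n y) = J1"
        "\<And>y. y \<in> ?I \<Longrightarrow> bernoulli c \<gamma> R A (u y) (n y) (S y) = B" "\<And>y. y \<in> ?I \<Longrightarrow> S y = \<sigma>"
      by (rule smooth_region_constants[of ?I u n S, OF _ state eulerI]) (use sub in auto)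
    have r1I: "r1 \<in> ?I"
      using rs by simp
    have "J1 = J" "B = c * H"
      using *(1,2)[OF r1I] state_fluxes(1,2)[OF flux_pos[of r1], of v0] v0 sonic r1
      by (auto simp: inlet)
    moreover have "\<sigma> = entropy_level J up_level"
      using *(3)[OF r1I] r1 by (simp add: inlet state_entropy_eq[OF J] up_level_def)
    ultimately have region: "x\<^sup>2 * mass_flux c (u x) (n x) = J" "bernoulli c \<gamma> R A (u x) (n x) (S x) = c * H"
      "S x = entropy_level J up_level" if "x \<in> ?I" for x
      using *[OF that] by auto
    have st: "0 < ?v x" "?v x < vmax" "n x = rest_density (J / x\<^sup>2) (?v x)"
        "log_flux (?v x) = up_level - 2 * ln x" if "x \<in> ?I" for x
      using region_state[OF _ _ _ region[OF that]] state[of x] sub that by auto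
    \<comment> \<open>The inlet is supersonic and \<open>log_flux\<close> stays below its maximum, which selects the branch.\<close>
    have "?v x \<noteq> sonic" if "x \<in> ?I" for x
      using st(4)[OF that] upstream_regular(1)[of x] that by auto
    then have "?v r1 < sonic \<longleftrightarrow> ?v y < sonic"
      by (intro continuous_avoids_value[OF _ v_cont(1) _ r1I y]) auto
    moreover have "\<not> ?v r1 < sonic"
      using inlet(1) v0 c_pos by simp
    ultimately have "sonic < ?v y"
      using \<open>\<And>x. x \<in> ?I \<Longrightarrow> ?v x \<noteq> sonic\<close>[OF y] by simp
    then have up: "upstream y = ?v y"
      using sup_branch_log_flux[of "?v y"] st(2,4)[OF y] by (simp add: upstream_def)
    then show "u y = c * upstream y"
      using c_pos by simp
    show "n y = rest_density (J / y\<^sup>2) (upstream y)"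
      using st(3)[OF y] by (simp add: up)
    show "y\<^sup>2 * mass_flux c (u y) (n y) = J" "bernoulli c \<gamma> R A (u y) (n y) (S y) = c * H"
        "S y = entropy_level J up_level"
      by (fact region[OF y])+
  qed

  obtain J2 B2 \<sigma>2 where right:
    "\<And>y. y \<in> ?K \<Longrightarrow> y\<^sup>2 * mass_flux c (u y) (n y) = J2"
    "\<And>y. y \<in> ?K \<Longrightarrow> bernoulli c \<gamma> R A (u y) (n y) (S y) = B2" "\<And>y. y \<in> ?K \<Longrightarrow> S y = \<sigma>2"
    by (rule smooth_region_constants[of ?K u n S, OF _ state eulerK]) (use sub in auto)
  have J2: "J2 = J"
  proof -
    have l: "mass_flux c (u y) (n y) = J / y\<^sup>2" if "r1 < y" "y < rs" for y
      using left(3)[of y] that r1 by (auto simp: field_simps)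
    have r: "mass_flux c (u y) (n y) = J2 / y\<^sup>2" if "rs < y" "y < r2" for y
      using right(1)[of y] that rs r1 by (auto simp: field_simps)
    have "has_jump (\<lambda>y. mass_flux c (u y) (n y)) 0 rs"
      using sol by (simp add: shock_solution_def)
    then show ?thesis
      using has_jump_pieces[OF rs l r sq sq, where j = 0] rs r1 by simp
  qed
  have B2: "B2 = c * H"
  proof -
    have l: "bernoulli c \<gamma> R A (u y) (n y) (S y) = (\<lambda>_. c * H) y" if "r1 < y" "y < rs" for y
      using left(4)[of y] that by simp
    have r: "bernoulli c \<gamma> R A (u y) (n y) (S y) = (\<lambda>_. B2) y" if "rs < y" "y < r2" for y
      using right(2)[of y] that by simp
    have "has_jump (\<lambda>y. bernoulli c \<gamma> R A (u y) (n y) (S y)) 0 rs"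
      using sol by (simp add: shock_solution_def)
    then show ?thesis
      using has_jump_pieces[OF rs l r, where j = 0] by simp
  qed
  have \<sigma>2: "entropy_level J up_level < \<sigma>2"
  proof -
    have l: "S y = (\<lambda>_. entropy_level J up_level) y" if "r1 < y" "y < rs" for y
      using left(5)[of y] that by simp
    have r: "S y = (\<lambda>_. \<sigma>2) y" if "rs < y" "y < r2" for y
      using right(3)[of y] that by simp
    obtain j where "0 < j" "has_jump S j rs"
      using sol by (auto simp: shock_solution_def)
    then show ?thesis
      using has_jump_pieces[OF rs l r, where j = j] by simp
  qed
  define C where "C = \<sigma>2 / R + ln J + (offset + ln A) / (\<gamma> - 1)"
  have C: "\<sigma>2 = entropy_level J C"
    using R_pos by (simp add: C_def entropy_level_def)
  have "up_level < C"
    using \<sigma>2 by (simp add: C entropy_level_less_iff)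
  have st: "0 < ?v y" "?v y < vmax" "u y = c * ?v y" "n y = rest_density (J / y\<^sup>2) (?v y)"
      "S y = state_entropy (J / y\<^sup>2) (?v y)" "log_flux (?v y) = C - 2 * ln y" if "y \<in> ?K" for y
    by (rule region_state[OF _ _ _ right[OF that, unfolded J2 B2 C]];
        use state[of y] sub rs that in auto)+

  obtain b where "(u \<longlongrightarrow> b) (at_right rs)"
    using piecewise_smooth_continuous_on(2)[OF ps] by blast
  then have lim: "(?v \<longlongrightarrow> b / c) (at_right rs)"
    using c_pos by (intro tendsto_divide tendsto_const) auto
  define l where "l = b / c"
  note l = downstream_limit_regular[OF rs _ lim, of C, folded l_def]
  have l: "0 < l" "l < vmax" "log_flux l = C - 2 * ln rs"
    using l st(1,2,6) by auto
  \<comment> \<open>The momentum fluxes at the shock have the common factor \<open>c\<^sup>2 J / rs\<^sup>2\<close>.\<close>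
  have "impulse l = impulse (upstream rs)"
  proof -
    let ?f = "\<lambda>y. c\<^sup>2 * (J / y\<^sup>2 * impulse (upstream y))"
    have f: "isCont ?f rs"
      using upstream_deriv[of rs] upstream_regular[of rs] upstream[of rs] rs sq
      by (intro continuous_mult continuous_const isCont_o2[OF _ impulse_cont]) (auto dest: DERIV_isCont)
    have m: "momentum_flux c \<gamma> R A (u y) (n y) (S y) = ?f y" if "r1 < y" "y < rs" for y
    proof -
      have y: "y \<in> ?I" "r1 \<le> y"
        using that by auto
      have S: "S y = state_entropy (J / y\<^sup>2) (upstream y)"
        using left(5)[OF y(1)] upstream(4)[OF y(2)] y r1 state_entropy_eq[OF J, of y] by simp
      show ?thesis
        unfolding left(1,2)[OF y(1)] S by (rule state_fluxes(3)[OF flux_pos upstream(3,2)]) (rule y)+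
    qed
    have 1: "((\<lambda>y. momentum_flux c \<gamma> R A (u y) (n y) (S y)) \<longlongrightarrow> ?f rs) (at_left rs)"
      by (rule tendsto_at_left_eq[OF rs(1) m f])
    have imp: "((\<lambda>y. impulse (?v y)) \<longlongrightarrow> impulse l) (at_right rs)"
      by (rule isCont_tendsto_compose[OF impulse_cont[OF l(1,2)] lim[folded l_def]])
    have "((\<lambda>y. J / y\<^sup>2) \<longlongrightarrow> J / rs\<^sup>2) (at_right rs)"
      by (rule tendsto_at_right_eq[OF rs(2) refl sq])
    then have "((\<lambda>y. c\<^sup>2 * (J / y\<^sup>2 * impulse (?v y))) \<longlongrightarrow> c\<^sup>2 * (J / rs\<^sup>2 * impulse l)) (at_right rs)"
      by (intro tendsto_mult tendsto_const imp)
    moreover have "\<forall>\<^sub>F y in at_right rs. c\<^sup>2 * (J / y\<^sup>2 * impulse (?v y)) = momentum_flux c \<gamma> R A (u y) (n y) (S y)"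
      using eventually_at_right_real[OF rs(2)]
    proof eventually_elim
      case (elim y)
      then have y: "y \<in> ?K" and "r1 \<le> y"
        using rs by auto
      have "momentum_flux c \<gamma> R A (c * ?v y) (rest_density (J / y\<^sup>2) (?v y)) (state_entropy (J / y\<^sup>2) (?v y))
          = c\<^sup>2 * (J / y\<^sup>2 * impulse (?v y))"
        using \<open>r1 \<le> y\<close> by (intro state_fluxes(3) flux_pos st(1,2)[OF y])
      then show ?case
        by (simp only: st(3-5)[OF y, symmetric])
    qed
    ultimately have 2: "((\<lambda>y. momentum_flux c \<gamma> R A (u y) (n y) (S y)) \<longlongrightarrow>
        c\<^sup>2 * (J / rs\<^sup>2 * impulse l)) (at_right rs)"
      by (rule Lim_transform_eventually)
    have "has_jump (\<lambda>y. momentum_flux c \<gamma> R A (u y) (n y) (S y)) 0 rs"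
      using sol by (simp add: shock_solution_def)
    then show ?thesis
      using has_jump_iff[OF 1 2, where j = 0] c_pos J rs r1 by auto
  qed
  moreover have "l \<noteq> upstream rs"
    using l(3) upstream(4)[of rs] rs \<open>up_level < C\<close> by auto
  ultimately have l_eq: "l = post_shock (upstream rs)"
    using rs l by (intro post_shock_unique upstream) auto
  have down_level: "C = down_level rs"
    using l(3) down_level_eq[of rs] rs l_eq by simp

  have right': "u y = c * downstream rs y" "n y = rest_density (J / y\<^sup>2) (downstream rs y)"
      "S y = entropy_level J (down_level rs)" if y: "y \<in> ?K" for y
  proof -
    \<comment> \<open>Behind the shock the speed starts below the sonic one and cannot reach it.\<close>
    have "l < sonic"
      using post_shock(2)[OF upstream(1,2)[of rs]] l_eq rs by simp
    then have "\<forall>\<^sub>F y in at_right rs. ?v y < sonic"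
      using order_tendstoD(2)[OF lim] by (simp add: l_def)
    then have "\<forall>\<^sub>F y in at_right rs. ?v y < sonic \<and> y \<in> {rs<..<r2}"
      using eventually_at_right_real[OF rs(2)] by (rule eventually_conj)
    then obtain x where x: "?v x < sonic" "x \<in> ?K"
      using eventually_happens'[of "at_right rs"] by fastforce
    have "?v z \<noteq> sonic" if "z \<in> ?K" for z
      using st(6)[OF that] downstream_regular(1)[of rs z] rs that by (auto simp: down_level)
    then have "?v x < sonic \<longleftrightarrow> ?v y < sonic"
      by (intro continuous_avoids_value[OF _ v_cont(2) _ x(2) y]) auto
    then have down: "downstream rs y = ?v y"
      using x sub_branch_log_flux[of "?v y"] st(1,6)[OF y] by (simp add: downstream_def down_level)
    then show "u y = c * downstream rs y"
      using c_pos by simp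
    show "n y = rest_density (J / y\<^sup>2) (downstream rs y)"
      using st(4)[OF y] by (simp add: down)
    show "S y = entropy_level J (down_level rs)"
      using right(3)[OF y] by (simp add: C down_level)
  qed

  show eq: "u y = shock_u rs y \<and> n y = shock_n rs y \<and> S y = shock_S rs y" if "y \<in> ?D" for y
    using left(1,2,5)[of y] right'[of y] that by (auto simp: shock_u_def shock_n_def shock_S_def speed_def)
  have "pe = p (n r2) (S r2)"
    using sol by (simp add: shock_solution_def)
  also have "\<dots> = exit_pressure rs"
    using eq[of r2] shock_fluxes(4)[OF rs(1), of r2] rs
    by (simp add: exit_pressure_def speed_def Let_def)
  finally show "pe = exit_pressure rs" .
qed

section \<open>The exit pressure as a function of the shock position\<close>

text \<open>
  Moving the shock outwards strengthens it, hence raises the entropy downstream, the exit value of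
  \<open>log_flux\<close> and the subsonic exit speed; the pressure factor \<open>s w / v\<close> drops.
\<close>

lemma exit_pressure_less:
  assumes "r1 \<le> rs" "rs < rs'" "rs' \<le> r2"
  shows "exit_pressure rs' < exit_pressure rs"
proof -
  let ?v = "downstream rs r2" and ?v' = "downstream rs' r2"
  have "down_level rs < down_level rs'"
    using entropy_gain_less[of "upstream rs" "upstream rs'"] upstream(1)[of rs] upstream(2)[of rs']
      upstream_less[OF assms(1,2)] assms
    by (simp add: down_level_def)
  moreover have "rs \<le> r2" "r1 \<le> rs'"
    using assms by auto
  note d = downstream[OF assms(1) this(1)] and d' = downstream[OF this(2) assms(3)]
  ultimately have "log_flux ?v < log_flux ?v'"
    by (simp add: d(4) d'(4))
  then have v: "?v < ?v'"
    using log_flux_less_sub_iff[of ?v ?v'] d(1,2) d'(1,2) by simp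
  note pos = thermal_pos[of ?v'] d(1) d'(1,3)
  have l: "lor ?v' < lor ?v"
    using lor_less[of ?v ?v'] v d(1) by simp
  then have t: "thermal ?v' < thermal ?v"
    using level by (simp add: thermal_def)
  have "lor ?v' * thermal ?v' < lor ?v * thermal ?v"
    using pos l t by (intro mult_strict_mono) auto
  then have "lor ?v' * thermal ?v' / ?v' < lor ?v * thermal ?v / ?v"
    using pos v by (intro frac_less) auto
  moreover have "0 < \<kappa> * c\<^sup>2 * (J / r2\<^sup>2)"
    using kappa c_pos J r1 r12 by simp
  ultimately show ?thesis
    unfolding exit_pressure_def Let_def by (rule mult_strict_left_mono)
qed

lemma exit_pressure_pos:
  assumes "r1 \<le> rs" "rs \<le> r2"
  shows "0 < exit_pressure rs"
  using downstream[OF assms] thermal_pos[of "downstream rs r2"] kappa c_pos J r1 r12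
  by (simp add: exit_pressure_def Let_def)

lemma exit_pressure_cont: "continuous_on {r1..r2} exit_pressure"
proof (intro continuous_at_imp_continuous_on ballI)
  fix rs assume "rs \<in> {r1..r2}"
  then have rs: "r1 \<le> rs" "rs \<le> r2" by auto
  have "isCont upstream rs"
    using upstream_deriv[OF upstream_regular(2)[OF rs(1)]] by (auto dest: DERIV_isCont)
  then have "isCont down_level rs"
    unfolding down_level_def[abs_def]
    by (intro continuous_add continuous_const isCont_o2[OF _ entropy_gain_cont] upstream rs)
  then have "isCont (\<lambda>rs. down_level rs - 2 * ln r2) rs"
    by (intro continuous_intros)
  then have d: "isCont (\<lambda>rs. downstream rs r2) rs"
    unfolding downstream_def
    by (rule isCont_o2) (rule DERIV_isCont[OF sub_branch_deriv[OF downstream_regular(1)[OF rs]]])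
  have "isCont lor (downstream rs r2)" "isCont thermal (downstream rs r2)"
    unfolding thermal_def[abs_def] lor_def[abs_def] by (intro continuous_intros)+
  then have "isCont (\<lambda>v. lor v * thermal v / v) (downstream rs r2)"
    using downstream(1)[OF rs] by (intro continuous_intros) auto
  then show "isCont exit_pressure rs"
    unfolding exit_pressure_def[abs_def] Let_def
    by (intro continuous_mult continuous_const isCont_o2[OF d])
qed

lemma ex_shock_position:
  assumes "exit_pressure r2 < pe" "pe < exit_pressure r1"
  shows "\<exists>rs. r1 < rs \<and> rs < r2 \<and> exit_pressure rs = pe"
proof -
  obtain rs where "r1 \<le> rs" "rs \<le> r2" "exit_pressure rs = pe"
    using IVT2'[of exit_pressure r2 pe r1] exit_pressure_cont assms r12 by auto
  then show ?thesis
    using assms by (intro exI[of _ rs]) (auto simp: less_le)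
qed

text \<open>
  Strict monotonicity of the exit pressure is used twice: it makes the shock position unique, and it
  orders the positions that belong to different exit pressures.
\<close>

lemma well_posed:
  defines "solution \<equiv> shock_solution c \<gamma> R A r1 r2
    (c * v0) (rest_density (J / r1\<^sup>2) v0) (state_entropy (J / r1\<^sup>2) v0)"
  shows "\<exists>P1 P2. 0 < P1 \<and> P1 < P2 \<and>
    (\<forall>pe\<in>{P1<..<P2}. \<exists>rs u n S. solution pe rs u n S \<and>
       (\<forall>rs' u' n' S'. solution pe rs' u' n' S' \<longrightarrow>
          rs' = rs \<and> (\<forall>y\<in>{r1..r2} - {rs}. u' y = u y \<and> n' y = n y \<and> S' y = S y))) \<and>
    (\<forall>pe\<in>{P1<..<P2}. \<forall>pe'\<in>{P1<..<P2}. \<forall>rs u n S rs' u' n' S'.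
       solution pe rs u n S \<longrightarrow> solution pe' rs' u' n' S' \<longrightarrow> pe' < pe \<longrightarrow> rs < rs')"
proof -
  note sol_eq = shock_solution_eq[folded solution_def]
  let ?P = "{exit_pressure r2<..<exit_pressure r1}"
  have pos: "0 < exit_pressure r2" "exit_pressure r2 < exit_pressure r1"
    using r12 exit_pressure_pos exit_pressure_less by auto
  have "rs < rs'" if "solution pe rs u n S" "solution pe' rs' u' n' S'" "pe' < pe"
    for pe pe' rs rs' u u' n n' S S'
  proof (rule ccontr)
    assume "\<not> rs < rs'"
    then have "exit_pressure rs \<le> exit_pressure rs'"
      using exit_pressure_less[of rs' rs] sol_eq(1,2)[OF that(1)] sol_eq(1,2)[OF that(2)]
      by (cases "rs = rs'") auto
    then show False
      using sol_eq(3)[OF that(1)] sol_eq(3)[OF that(2)] that(3) by simp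
  qed
  then have monotone: "\<forall>pe\<in>?P. \<forall>pe'\<in>?P. \<forall>rs u n S rs' u' n' S'.
       solution pe rs u n S \<longrightarrow> solution pe' rs' u' n' S' \<longrightarrow> pe' < pe \<longrightarrow> rs < rs'"
    by blast
  have unique: "\<forall>pe\<in>?P. \<exists>rs u n S. solution pe rs u n S \<and>
       (\<forall>rs' u' n' S'. solution pe rs' u' n' S' \<longrightarrow>
          rs' = rs \<and> (\<forall>y\<in>{r1..r2} - {rs}. u' y = u y \<and> n' y = n y \<and> S' y = S y))"
  proof
    fix pe assume "pe \<in> ?P"
    then obtain rs where rs: "r1 < rs" "rs < r2" "exit_pressure rs = pe"
      using ex_shock_position by auto
    have "solution pe rs (shock_u rs) (shock_n rs) (shock_S rs)"
      using shock_solution_exists[OF rs(1,2)] by (simp add: solution_def rs(3))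
    moreover have "rs' = rs \<and> (\<forall>y\<in>{r1..r2} - {rs}. u' y = shock_u rs y \<and> n' y = shock_n rs y \<and> S' y = shock_S rs y)"
      if "solution pe rs' u' n' S'" for rs' u' n' S'
    proof -
      note s = sol_eq[OF that]
      have "rs' = rs"
        using exit_pressure_less[of rs rs'] exit_pressure_less[of rs' rs] s(1-3) rs
        by (cases rs rs' rule: linorder_cases) auto
      then show ?thesis
        using s(4) by auto
    qed
    ultimately show "\<exists>rs u n S. solution pe rs u n S \<and>
         (\<forall>rs' u' n' S'. solution pe rs' u' n' S' \<longrightarrow>
            rs' = rs \<and> (\<forall>y\<in>{r1..r2} - {rs}. u' y = u y \<and> n' y = n y \<and> S' y = S y))"
      by blast
  qed
  show ?thesis
    by (rule exI[of _ "exit_pressure r2"], rule exI[of _ "exit_pressure r1"])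
      (intro conjI pos unique monotone)
qed

end

theorem proposition1p2:
  fixes c \<gamma> R A r1 r2 u0 n0 S0 :: real
  assumes "c > 0" and "\<gamma> > 1" and "R > 0" and "A > 0"
    and "0 < r1" and "r1 < r2"
    and "0 < u0" and "u0 < c" and "n0 > 0" and "S0 > 0"
    and "u0\<^sup>2 > (sound_speed c \<gamma> R A n0 S0)\<^sup>2"
    and "(sound_speed c \<gamma> R A n0 S0)\<^sup>2 > 0"
  shows "\<exists>P1 P2. 0 < P1 \<and> P1 < P2 \<and>
    (\<forall>pe\<in>{P1<..<P2}. \<exists>rs u n S.
       shock_solution c \<gamma> R A r1 r2 u0 n0 S0 pe rs u n S \<and>
       (\<forall>rs' u' n' S'. shock_solution c \<gamma> R A r1 r2 u0 n0 S0 pe rs' u' n' S' \<longrightarrow>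
          rs' = rs \<and> (\<forall>y\<in>{r1..r2} - {rs}. u' y = u y \<and> n' y = n y \<and> S' y = S y))) \<and>
    (\<forall>pe\<in>{P1<..<P2}. \<forall>pe'\<in>{P1<..<P2}. \<forall>rs u n S rs' u' n' S'.
       shock_solution c \<gamma> R A r1 r2 u0 n0 S0 pe rs u n S \<longrightarrow>
       shock_solution c \<gamma> R A r1 r2 u0 n0 S0 pe' rs' u' n' S' \<longrightarrow>
       pe' < pe \<longrightarrow> rs < rs')"
proof -
  interpret polytropic_gas c \<gamma> R A
    using assms by unfold_locales
  define v0 where "v0 = u0 / c"
  define w where "w = heat_ratio n0 S0"
  define H where "H = (1 + w) / lor v0"
  define j where "j = n0 * v0 / lor v0"
  have u0: "u0 = c * v0"
    using assms by (simp add: v0_def)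
  have v0: "0 < v0" "\<bar>v0\<bar> < 1"
    using assms by (auto simp: v0_def)
  have lor: "0 < lor v0" "lor v0 \<le> 1"
    using lor_pos[OF v0(2)] by (auto simp: lor_def)
  have w: "0 < w"
    using heat_ratio_pos assms by (simp add: w_def)
  interpret gas_flow c \<gamma> R A H
    using assms lor w by unfold_locales (auto simp: H_def less_divide_eq)
  have thermal: "thermal v0 = w"
    using lor by (simp only: thermal_def) (simp add: H_def)
  have j: "0 < j"
    using assms v0 lor by (simp add: j_def)
  have state: "v0 < vmax" "n0 = rest_density j v0" "S0 = state_entropy j v0"
    using state_iff[OF v0(2) _ j, of n0 S0] assms
    by (auto simp: mass_flux_eq bernoulli_eq j_def H_def w_def)
  have "(\<gamma> - 1) * c\<^sup>2 * w / (1 + w) < c\<^sup>2 * v0\<^sup>2"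
    using assms sound_speed_power2[of n0 S0] by (simp add: w_def u0 power_mult_distrib)
  also have "(\<gamma> - 1) * c\<^sup>2 * w / (1 + w) = c\<^sup>2 * ((\<gamma> - 1) * w / (1 + w))"
    by simp
  finally have "(\<gamma> - 1) * w / (1 + w) < v0\<^sup>2"
    using c_pos by (simp only: mult_less_cancel_left_pos zero_less_power)
  then have "sonic < v0"
    using supersonic_iff[OF v0(1) state(1)] by (simp add: thermal)
  then interpret shock_problem c \<gamma> R A H r1 r2 "j * r1\<^sup>2" v0
    using assms j state by unfold_locales auto
  have "j * r1\<^sup>2 / r1\<^sup>2 = j"
    using assms by simp
  then show ?thesis
    using well_posed state u0 by simp
qed

end
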